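(* Let $(\mu,\nu,\mathcal C)$ be a Gårding–Wightman triple on $X=\mathbb Z_2^\infty$. The representation $V(\mu,\nu,\mathcal C)$ admits an invariant quaternionic structure if and only if the measures $\mu$ and $\check\mu$ are equivalent, $\check\nu(x)=\nu(x)$ for almost all $x\in X$, and there exists a measurable family of operators $$q(x):V_x\to V_{\check x}\cong V_x$$ which are $\mathbb C$-antilinear, preserve the norm, and satisfy $$q(x)q(\check x)=-1,\qquad q(x)c_k(\check x)=(-1)^k c_k(x)\,q(x+\delta^k)$$ for all $k\ge 1$ and almost all $x\in X$.
   Context: $X=\mathbb Z_2^{\infty}$ is the compact abelian group of sequences $x=(x_1,x_2,\dots)$ of $0$'s and $1$'s with componentwise addition mod $2$, the product topology and its Borel $\sigma$-algebra. $\delta^k\in X$ has a $1$ in position $k$ and $0$ elsewhere; $\Delta\subset X$ is the subgroup of sequences with finitely many $1$'s. $\check x=x+\mathbf 1$, $\mathbf 1=(1,1,\dots)$, interchanges all $0$'s and $1$'s; $\check f(x)=f(\check x)$ for functions and $\check\mu(A)=\mu(\check A)$ for measures, where $\check A=\{\check x:x\in A\}$. Measures are equivalent if mutually absolutely continuous. A Gårding–Wightman triple $(\mu,\nu,\mathcal C)$ consists of: (1) a $\sigma$-finite positive Borel measure $\mu$ on $X$, quasi-invariant under $\Delta$, i.e. for each $\delta\in\Delta$ the measure $A\mapsto\mu(A+\delta)$ is equivalent to $\mu$; (2) a family $\{V_x\}_{x\in X}$ of nonzero separable complex Hilbert spaces with $V_{x+\delta}=V_x$ for $\delta\in\Delta$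 and almost all $x$, and with $\nu(x)=\dim V_x$ measurable; changing this family unitarily gives equivalent representations, so $V_x$ is taken to be a fixed model Hilbert space of dimension $\nu(x)$, and in particular $V_{\check x}=V_x$ whenever $\nu(\check x)=\nu(x)$; (3) a family $\mathcal C=\{c_k(x):k\ge 1,x\in X\}$ of unitary operators $c_k(x):V_x\to V_{x+\delta^k}=V_x$, depending measurably on $x$, with $c_k(x)^*=c_k(x+\delta^k)$ and $c_k(x)c_l(x+\delta^k)=c_l(x)c_k(x+\delta^l)$ for all $k,l$ and almost all $x$. $V=V(\mu,\nu,\mathcal C)=\int_X^\oplus V_x\,d\mu(x)$ carries the mutually anticommuting unitary operators of square $-I$ ($k\ge1$) $$J_kf(x)=-i(-1)^{x_1+\dots+x_{k-1}}c_k(x)\sqrt{\tfrac{d\mu(x+\delta^k)}{d\mu(x)}}f(x+\delta^k),\quad J_k'f(x)=(-1)^{x_1+\dots+x_{k}}c_k(x)\sqrt{\tfrac{d\mu(x+\delta^k)}{d\mu(x)}}f(x+\delta^k),$$ where $d\mu(x+\delta^k)/d\mu(x)$ is the Radon–Nikodym derivative of $A\mapsto\mu(A+\delta^k)$ with respect to $\mu$; they define a representation of the Clifford algebra $C(H)$ of an infinite-dimensional separable real prehilbert space $H$. An invariant quaternionic structure on $V$ is a $\mathbb C$-antilinear norm-preserving operator $Q:V\to V$ with $Q^2=-I$ commuting with all $J_k,J_k'$. *)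

theory Defs
  imports "HOL-Analysis.Analysis" "HOL-Library.Z2" "HOL-Library.Function_Algebras"
begin

section \<open>The group \<open>X\<close> of 0-1 sequences\<close>

instantiation bit :: discrete_topology
begin

definition open_bit :: "bit set \<Rightarrow> bool"
  where "open_bit A \<longleftrightarrow> True"

instance
  by standard (simp_all add: open_bit_def)

end

instance bit :: second_countable_topology
proof
  have "finite (UNIV :: bit set)"
    by (rule finite_subset[of _ "{0, 1}"]) (auto intro: bit.exhaust)
  hence "countable (UNIV :: bit set set)"
    by (simp add: Finite_Set.finite_set countable_finite)
  moreover have "open = generate_topology (UNIV :: bit set set)"
    by (auto simp: fun_eq_iff open_bit_def intro: generate_topology.Basis)
  ultimately show "\<exists>B :: bit set set. countable B \<and> open = generate_topology B"
    by blast
qed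

text \<open>Positions are counted from 0: the coordinate \<open>x\<^sub>k\<close> of the mathematics (\<open>k \<ge> 1\<close>) is
  \<open>x (k - 1)\<close>, and likewise \<open>\<delta>\<^sup>k\<close>, \<open>c\<^sub>k\<close>, \<open>J\<^sub>k\<close>, \<open>J\<^sub>k'\<close> are \<open>\<delta> (k - 1)\<close>, \<open>c (k - 1)\<close>, etc.
  The type carries the pointwise group structure and the product topology of discrete \<open>bit\<close>.\<close>

type_synonym cantor = "nat \<Rightarrow> bit"

definition \<delta> :: "nat \<Rightarrow> cantor"
  where "\<delta> k = (\<lambda>j. if j = k then 1 else 0)"

definition \<Delta> :: "cantor set"
  where "\<Delta> = {x. finite {k. x k = 1}}"

definition check :: "cantor \<Rightarrow> cantor"
  where "check x = x + (\<lambda>_. 1)"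

text \<open>Translation by \<open>d\<close> and \<open>check\<close> are involutions, so the preimages occurring in \<open>distr\<close> are the images:
  these are the measures \<open>A \<mapsto> \<mu> (A + d)\<close> and \<open>A \<mapsto> \<mu> (check ` A)\<close>.\<close>

definition translate_measure :: "cantor measure \<Rightarrow> cantor \<Rightarrow> cantor measure"
  where "translate_measure \<mu> d = distr \<mu> \<mu> (\<lambda>x. x + d)"

definition check_measure :: "cantor measure \<Rightarrow> cantor measure"
  where "check_measure \<mu> = distr \<mu> \<mu> check"

definition equivalent_measures :: "'a measure \<Rightarrow> 'a measure \<Rightarrow> bool"
  where "equivalent_measures M N \<longleftrightarrow>
    sets M = sets N \<and> absolutely_continuous M N \<and> absolutely_continuous N M"

section \<open>Model Hilbert spaces\<close>

type_synonym vec = "nat \<Rightarrow> complex"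

text \<open>The model Hilbert space of dimension \<open>n \<in> {0, 1, \<dots>, \<infinity>}\<close>: the square-summable
  sequences supported on \<open>{i. i < n}\<close>.\<close>

definition hilb :: "enat \<Rightarrow> vec set"
  where "hilb n = {v. (\<forall>i. n \<le> enat i \<longrightarrow> v i = 0) \<and> summable (\<lambda>i. (cmod (v i))\<^sup>2)}"

definition hscale :: "complex \<Rightarrow> vec \<Rightarrow> vec"
  where "hscale a v = (\<lambda>i. a * v i)"

definition hinner :: "vec \<Rightarrow> vec \<Rightarrow> complex"
  where "hinner v w = (\<Sum>i. v i * cnj (w i))"

definition hnorm :: "vec \<Rightarrow> real"
  where "hnorm v = sqrt (\<Sum>i. (cmod (v i))\<^sup>2)"

definition unitary_between :: "vec set \<Rightarrow> vec set \<Rightarrow> (vec \<Rightarrow> vec) \<Rightarrow> bool"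
  where "unitary_between H K T \<longleftrightarrow>
    (\<forall>v\<in>H. \<forall>w\<in>H. T (v + w) = T v + T w) \<and>
    (\<forall>a. \<forall>v\<in>H. T (hscale a v) = hscale a (T v)) \<and>
    (\<forall>v\<in>H. \<forall>w\<in>H. hinner (T v) (T w) = hinner v w) \<and>
    T ` H = K"

definition adjoint_between :: "vec set \<Rightarrow> vec set \<Rightarrow> (vec \<Rightarrow> vec) \<Rightarrow> (vec \<Rightarrow> vec) \<Rightarrow> bool"
  where "adjoint_between H K T S \<longleftrightarrow>
    S ` K \<subseteq> H \<and> (\<forall>v\<in>H. \<forall>w\<in>K. hinner (T v) w = hinner v (S w))"

definition antilinear_isometry_between :: "vec set \<Rightarrow> vec set \<Rightarrow> (vec \<Rightarrow> vec) \<Rightarrow> bool"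
  where "antilinear_isometry_between H K T \<longleftrightarrow>
    T ` H \<subseteq> K \<and>
    (\<forall>v\<in>H. \<forall>w\<in>H. T (v + w) = T v + T w) \<and>
    (\<forall>a. \<forall>v\<in>H. T (hscale a v) = hscale (cnj a) (T v)) \<and>
    (\<forall>v\<in>H. hnorm (T v) = hnorm v)"

section \<open>Measurable fields\<close>

text \<open>Everything is determined only up to \<open>\<mu>\<close>-null sets, so measurability of fields of vectors
  and of operators is understood with respect to the completion of \<open>\<mu>\<close> (equivalently: Borel
  measurability after a change on a \<open>\<mu>\<close>-null set).  A field of operators is measurable if it
  maps measurable vector fields to measurable vector fields.\<close>

definition measurable_field :: "cantor measure \<Rightarrow> (cantor \<Rightarrow> enat) \<Rightarrow> (cantor \<Rightarrow> vec) \<Rightarrow> bool"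
  where "measurable_field \<mu> \<nu> f \<longleftrightarrow>
    (\<forall>i. (\<lambda>x. f x i) \<in> borel_measurable (completion \<mu>)) \<and> (AE x in \<mu>. f x \<in> hilb (\<nu> x))"

definition measurable_operator_field ::
    "cantor measure \<Rightarrow> (cantor \<Rightarrow> enat) \<Rightarrow> (cantor \<Rightarrow> vec \<Rightarrow> vec) \<Rightarrow> bool"
  where "measurable_operator_field \<mu> \<nu> T \<longleftrightarrow>
    (\<forall>f. measurable_field \<mu> \<nu> f \<longrightarrow>
      (\<forall>i. (\<lambda>x. T x (f x) i) \<in> borel_measurable (completion \<mu>)))"

section \<open>Garding-Wightman triples\<close>

text \<open>The family \<open>V\<^sub>x\<close> is \<open>hilb (\<nu> x)\<close>; so \<open>V\<^sub>y = V\<^sub>x\<close> exactly when \<open>\<nu> y = \<nu> x\<close>.\<close>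

locale garding_wightman_triple = sigma_finite_measure \<mu>
  for \<mu> :: "cantor measure" +
  fixes \<nu> :: "cantor \<Rightarrow> enat"
    and c :: "nat \<Rightarrow> cantor \<Rightarrow> vec \<Rightarrow> vec"
  assumes sets_mu: "sets \<mu> = sets borel"
    and quasi_invariant: "\<And>d. d \<in> \<Delta> \<Longrightarrow> equivalent_measures (translate_measure \<mu> d) \<mu>"
    and nu_measurable: "\<nu> \<in> measurable \<mu> (count_space UNIV)"
    and nu_nonzero: "\<And>x. \<nu> x \<noteq> 0"
    and nu_invariant: "\<And>d. d \<in> \<Delta> \<Longrightarrow> AE x in \<mu>. \<nu> (x + d) = \<nu> x"
    and c_measurable: "\<And>k. measurable_operator_field \<mu> \<nu> (c k)"
    and c_unitary:
      "\<And>k. AE x in \<mu>. unitary_between (hilb (\<nu> x)) (hilb (\<nu> (x + \<delta> k))) (c k x)"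
    and c_adjoint:
      "\<And>k. AE x in \<mu>.
        adjoint_between (hilb (\<nu> x)) (hilb (\<nu> (x + \<delta> k))) (c k x) (c k (x + \<delta> k))"
    and c_commute:
      "\<And>k l. AE x in \<mu>. \<forall>v\<in>hilb (\<nu> x).
        c k x (c l (x + \<delta> k) v) = c l x (c k (x + \<delta> l) v)"

section \<open>The direct integral and the operators on it\<close>

text \<open>Elements of the direct integral \<open>V(\<mu>, \<nu>, \<C>)\<close> are represented by square-integrable
  measurable fields, two of which represent the same element if they agree almost everywhere.\<close>

definition direct_integral :: "cantor measure \<Rightarrow> (cantor \<Rightarrow> enat) \<Rightarrow> (cantor \<Rightarrow> vec) set"
  where "direct_integral \<mu> \<nu> =
    {f. measurable_field \<mu> \<nu> f \<and> integrable (completion \<mu>) (\<lambda>x. (hnorm (f x))\<^sup>2)}"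

definition ae_eq :: "cantor measure \<Rightarrow> (cantor \<Rightarrow> vec) \<Rightarrow> (cantor \<Rightarrow> vec) \<Rightarrow> bool"
  where "ae_eq \<mu> f g \<longleftrightarrow> (AE x in \<mu>. f x = g x)"

definition l2norm :: "cantor measure \<Rightarrow> (cantor \<Rightarrow> vec) \<Rightarrow> real"
  where "l2norm \<mu> f = sqrt (\<integral>x. (hnorm (f x))\<^sup>2 \<partial>completion \<mu>)"

text \<open>\<open>(-1)\<close> to the power of the sum of the first \<open>k\<close> coordinates of \<open>x\<close>.\<close>

definition parity_sign :: "nat \<Rightarrow> cantor \<Rightarrow> complex"
  where "parity_sign k x = (-1) ^ (\<Sum>j<k. of_bool (x j = 1))"

definition sqrt_density :: "cantor measure \<Rightarrow> nat \<Rightarrow> cantor \<Rightarrow> real"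
  where "sqrt_density \<mu> k x = sqrt (enn2real (RN_deriv \<mu> (translate_measure \<mu> (\<delta> k)) x))"

definition J :: "cantor measure \<Rightarrow> (nat \<Rightarrow> cantor \<Rightarrow> vec \<Rightarrow> vec) \<Rightarrow> nat \<Rightarrow>
    (cantor \<Rightarrow> vec) \<Rightarrow> (cantor \<Rightarrow> vec)"
  where "J \<mu> c k f = (\<lambda>x.
    hscale (- \<i> * parity_sign k x * complex_of_real (sqrt_density \<mu> k x)) (c k x (f (x + \<delta> k))))"

definition J' :: "cantor measure \<Rightarrow> (nat \<Rightarrow> cantor \<Rightarrow> vec \<Rightarrow> vec) \<Rightarrow> nat \<Rightarrow>
    (cantor \<Rightarrow> vec) \<Rightarrow> (cantor \<Rightarrow> vec)"
  where "J' \<mu> c k f = (\<lambda>x.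
    hscale (parity_sign (Suc k) x * complex_of_real (sqrt_density \<mu> k x)) (c k x (f (x + \<delta> k))))"

text \<open>Operators on \<open>V(\<mu>, \<nu>, \<C>)\<close> are given by their action on representatives; the second
  conjunct says that \<open>Q\<close> is well defined, and equalities in \<open>V\<close> are equalities
  almost everywhere.\<close>

definition invariant_quaternionic_structure ::
    "cantor measure \<Rightarrow> (cantor \<Rightarrow> enat) \<Rightarrow> (nat \<Rightarrow> cantor \<Rightarrow> vec \<Rightarrow> vec) \<Rightarrow>
     ((cantor \<Rightarrow> vec) \<Rightarrow> (cantor \<Rightarrow> vec)) \<Rightarrow> bool"
  where "invariant_quaternionic_structure \<mu> \<nu> c Q \<longleftrightarrow>
    (let V = direct_integral \<mu> \<nu> in
      (\<forall>f\<in>V. Q f \<in> V) \<and>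
      (\<forall>f\<in>V. \<forall>g\<in>V. ae_eq \<mu> f g \<longrightarrow> ae_eq \<mu> (Q f) (Q g)) \<and>
      (\<forall>f\<in>V. \<forall>g\<in>V. ae_eq \<mu> (Q (f + g)) (Q f + Q g)) \<and>
      (\<forall>a. \<forall>f\<in>V. ae_eq \<mu> (Q (\<lambda>x. hscale a (f x))) (\<lambda>x. hscale (cnj a) (Q f x))) \<and>
      (\<forall>f\<in>V. l2norm \<mu> (Q f) = l2norm \<mu> f) \<and>
      (\<forall>f\<in>V. ae_eq \<mu> (Q (Q f)) (- f)) \<and>
      (\<forall>k. \<forall>f\<in>V. ae_eq \<mu> (Q (J \<mu> c k f)) (J \<mu> c k (Q f))) \<and>
      (\<forall>k. \<forall>f\<in>V. ae_eq \<mu> (Q (J' \<mu> c k f)) (J' \<mu> c k (Q f))))"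

end

theory Submission
  imports Defs
begin

text \<open>
  Let \<open>r\<close> be the square root of the density of the flipped measure.  A field \<open>q\<close> of antilinear
  isometries acts by \<open>(T f) x = r x \<cdot> q x (f (check x))\<close>, and the two conditions on \<open>q\<close> say
  exactly that \<open>T\<close> squares to \<open>-1\<close> and commutes with the Clifford operators.

  Conversely, \<open>J\<^sub>k J\<^sub>k'\<close> is multiplication by a function of \<open>x\<^sub>k\<close> with values \<open>\<plusminus>i\<close>.  An antilinear
  \<open>Q\<close> commuting with it exchanges the fields supported in \<open>x\<^sub>k = 0\<close> with those supported in
  \<open>x\<^sub>k = 1\<close>, hence maps fields supported in a cylinder set \<open>A\<close> to fields supported in the flip
  of \<open>A\<close>.  As cylinder sets determine finite measures, the measure with density
  \<open>\<parallel>Q f\<parallel>\<^sup>2\<close> is the flip of the one with density \<open>\<parallel>f\<parallel>\<^sup>2\<close>.  This gives the equivalence of the two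
  measures and the pointwise identity \<open>\<parallel>Q f x\<parallel> = r x \<cdot> \<parallel>f (check x)\<parallel>\<close>.  Applied to combinations
  of basis fields it shows that the rescaled images of the basis are orthonormal in almost every
  fibre, so they define \<open>q x\<close> with \<open>Q = T\<close>; counting dimensions at \<open>x\<close> and \<open>check x\<close> gives
  equality of the multiplicities.
\<close>

section \<open>Square-summable sequences\<close>

text \<open>For \<infinity> the support condition is vacuous, so \<open>hilb \<infinity>\<close>
  isolates square-summability; norm estimates are made there and the vanishing of coordinates is
  added separately.\<close>

lemma hilb_iff: "v \<in> hilb n \<longleftrightarrow> v \<in> hilb \<infinity> \<and> (\<forall>i. n \<le> enat i \<longrightarrow> v i = 0)"
  by (auto simp: hilb_def)

lemma sum_vec_apply: "(\<Sum>i\<in>A. v i) j = (\<Sum>i\<in>A. (v i :: vec) j)"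
  by (induction A rule: infinite_finite_induct) auto

lemma summable_hilb: "v \<in> hilb n \<Longrightarrow> summable (\<lambda>i. (cmod (v i))\<^sup>2)"
  by (auto simp: hilb_def)

lemma hnorm_nonneg [simp]: "v \<in> hilb n \<Longrightarrow> 0 \<le> hnorm v"
  by (simp add: hnorm_def suminf_nonneg summable_hilb)

lemma hnorm_sq: "v \<in> hilb n \<Longrightarrow> (hnorm v)\<^sup>2 = (\<Sum>i. (cmod (v i))\<^sup>2)"
  by (simp add: hnorm_def suminf_nonneg summable_hilb)

lemma sum_le_hnorm_sq: "v \<in> hilb n \<Longrightarrow> (\<Sum>i<N. (cmod (v i))\<^sup>2) \<le> (hnorm v)\<^sup>2"
  by (simp add: hnorm_sq sum_le_suminf summable_hilb)

text \<open>Meant for sums and coordinatewise limits whose summability is not known in advance: one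
  uniform bound on finite sections gives membership and the norm estimate together.\<close>

lemma hilb_infI_bounded:
  assumes "\<And>N. (\<Sum>i<N. (cmod (v i))\<^sup>2) \<le> B"
  shows "v \<in> hilb \<infinity>" "(hnorm v)\<^sup>2 \<le> B"
proof -
  have s: "summable (\<lambda>i. (cmod (v i))\<^sup>2)"
    by (rule summableI_nonneg_bounded[of _ B]) (auto simp: assms)
  then show v: "v \<in> hilb \<infinity>"
    by (simp add: hilb_def)
  show "(hnorm v)\<^sup>2 \<le> B"
    unfolding hnorm_sq[OF v] using s assms by (intro suminf_le_const) auto
qed

lemma norm_coord_le_hnorm: "v \<in> hilb n \<Longrightarrow> cmod (v i) \<le> hnorm v"
proof -
  assume v: "v \<in> hilb n"
  have "(cmod (v i))\<^sup>2 \<le> (\<Sum>j<Suc i. (cmod (v j))\<^sup>2)"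
    by (rule member_le_sum) auto
  also have "\<dots> \<le> (hnorm v)\<^sup>2"
    by (rule sum_le_hnorm_sq[OF v])
  finally show ?thesis
    by (rule power2_le_imp_le) (rule hnorm_nonneg[OF v])
qed

lemma hnorm_eq_0D: "v \<in> hilb n \<Longrightarrow> hnorm v = 0 \<Longrightarrow> v = 0"
  using norm_coord_le_hnorm[of v n] by (force simp: fun_eq_iff)

lemma hnorm_zero [simp]: "hnorm 0 = 0"
  by (simp add: hnorm_def)

lemma zero_in_hilb [simp]: "0 \<in> hilb n"
  by (simp add: hilb_def)

lemma hilb_hscale [simp]: "v \<in> hilb n \<Longrightarrow> hscale a v \<in> hilb n"
  by (auto simp: hilb_def hscale_def norm_mult power_mult_distrib intro: summable_mult)

lemma hnorm_hscale [simp]: "v \<in> hilb n \<Longrightarrow> hnorm (hscale a v) = cmod a * hnorm v"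
  by (simp add: hnorm_def hscale_def norm_mult power_mult_distrib suminf_mult
      summable_hilb real_sqrt_mult)

text \<open>Minkowski's inequality on finite sections has a bound independent of the section; this
  single bound yields closure under addition and the triangle inequality at once.\<close>

lemma
  assumes v: "v \<in> hilb n" and w: "w \<in> hilb n"
  shows hilb_add [simp]: "v + w \<in> hilb n"
    and hnorm_triangle: "hnorm (v + w) \<le> hnorm v + hnorm w"
proof -
  have *: "(\<Sum>i<N. (cmod ((v + w) i))\<^sup>2) \<le> (hnorm v + hnorm w)\<^sup>2" for N
  proof -
    have "L2_set (\<lambda>i. cmod ((v + w) i)) {..<N}
        \<le> L2_set (\<lambda>i. cmod (v i) + cmod (w i)) {..<N}"
      by (intro L2_set_mono) (auto intro: norm_triangle_ineq)
    also have "\<dots> \<le> L2_set (\<lambda>i. cmod (v i)) {..<N} + L2_set (\<lambda>i. cmod (w i)) {..<N}"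
      by (rule L2_set_triangle_ineq)
    also have "\<dots> \<le> hnorm v + hnorm w"
      unfolding L2_set_def using sum_le_hnorm_sq[OF v, of N] sum_le_hnorm_sq[OF w, of N]
      using hnorm_nonneg[OF v] hnorm_nonneg[OF w]
      by (intro add_mono real_le_lsqrt) (auto intro: sum_nonneg)
    finally have "sqrt (\<Sum>i<N. (cmod ((v + w) i))\<^sup>2) \<le> hnorm v + hnorm w"
      by (simp add: L2_set_def)
    then show ?thesis
      by (rule sqrt_le_D)
  qed
  show "v + w \<in> hilb n"
    using hilb_infI_bounded(1)[of "v + w", OF *] v w
      hilb_iff[of v n] hilb_iff[of w n] hilb_iff[of "v + w" n] by simp
  show "hnorm (v + w) \<le> hnorm v + hnorm w"
    using hilb_infI_bounded(2)[of "v + w", OF *] by (rule power2_le_imp_le) (simp add: hnorm_nonneg[OF v] hnorm_nonneg[OF w])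
qed

lemma uminus_eq_hscale: "- v = hscale (- 1) v"
  by (simp add: hscale_def fun_eq_iff)

lemma hilb_uminus [simp]: "v \<in> hilb n \<Longrightarrow> - v \<in> hilb n"
  by (simp add: uminus_eq_hscale)

lemma hilb_diff [simp]: "v \<in> hilb n \<Longrightarrow> w \<in> hilb n \<Longrightarrow> v - w \<in> hilb n"
  using hilb_add[of v n "- w"] by simp

lemma hnorm_uminus [simp]: "v \<in> hilb n \<Longrightarrow> hnorm (- v) = hnorm v"
  by (simp add: uminus_eq_hscale)

lemma hilb_sum [simp]: "(\<And>i. i \<in> A \<Longrightarrow> v i \<in> hilb n) \<Longrightarrow> (\<Sum>i\<in>A. v i) \<in> hilb n"
  by (induction A rule: infinite_finite_induct) auto

lemma hnorm_diff_commute: "v \<in> hilb n \<Longrightarrow> w \<in> hilb n \<Longrightarrow> hnorm (v - w) = hnorm (w - v)"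
  using hnorm_uminus[of "v - w" n] by simp

lemma hnorm_sum_le:
  "(\<And>i. i \<in> A \<Longrightarrow> v i \<in> hilb n) \<Longrightarrow> hnorm (\<Sum>i\<in>A. v i) \<le> (\<Sum>i\<in>A. hnorm (v i))"
proof (induction A rule: infinite_finite_induct)
  case (insert a A)
  have "hnorm (\<Sum>i\<in>insert a A. v i) = hnorm (v a + (\<Sum>i\<in>A. v i))"
    by (simp only: sum.insert[OF insert.hyps])
  also have "\<dots> \<le> hnorm (v a) + hnorm (\<Sum>i\<in>A. v i)"
    using insert.prems by (intro hnorm_triangle[of _ n] hilb_sum) auto
  also have "\<dots> \<le> hnorm (v a) + (\<Sum>i\<in>A. hnorm (v i))"
    using insert by auto
  also have "\<dots> = (\<Sum>i\<in>insert a A. hnorm (v i))"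
    by (rule sum.insert[OF insert.hyps, symmetric])
  finally show ?case .
qed auto

lemma hnorm_diff_le: "v \<in> hilb n \<Longrightarrow> w \<in> hilb n \<Longrightarrow> \<bar>hnorm v - hnorm w\<bar> \<le> hnorm (v - w)"
  using hnorm_triangle[of "v - w" n w] hnorm_triangle[of "w - v" n v] hnorm_diff_commute[of v n w]
  by simp

lemma hscale_simps [simp]:
  "hscale 0 v = 0" "hscale 1 v = v" "hscale a 0 = 0"
  "hscale a (hscale b v) = hscale (a * b) v"
  by (auto simp: hscale_def fun_eq_iff)

lemma hscale_add: "hscale a (v + w) = hscale a v + hscale a w"
  by (auto simp: hscale_def fun_eq_iff algebra_simps)

lemma hscale_sum: "hscale a (\<Sum>i\<in>A. v i) = (\<Sum>i\<in>A. hscale a (v i))"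
  by (simp add: hscale_def fun_eq_iff sum_vec_apply sum_distrib_left)

lemma hscale_eq_iff: "a \<noteq> 0 \<Longrightarrow> hscale a v = hscale a w \<longleftrightarrow> v = w"
  by (auto simp: hscale_def fun_eq_iff)

lemma tendsto_hnorm:
  assumes "v \<in> hilb n" "\<And>k. u k \<in> hilb n" "(\<lambda>k. hnorm (u k - v)) \<longlonglongrightarrow> 0"
  shows "(\<lambda>k. hnorm (u k)) \<longlonglongrightarrow> hnorm v"
proof (rule LIM_zero_cancel, rule Lim_null_comparison[OF _ assms(3)])
  show "\<forall>\<^sub>F k in sequentially. norm (hnorm (u k) - hnorm v) \<le> hnorm (u k - v)"
    using hnorm_diff_le[OF assms(2) assms(1)] by simp
qed

lemma tendsto_hnorm_coord:
  assumes "v \<in> hilb n" "\<And>k. u k \<in> hilb n" "(\<lambda>k. hnorm (u k - v)) \<longlonglongrightarrow> 0"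
  shows "(\<lambda>k. u k j) \<longlonglongrightarrow> v j"
proof (rule LIM_zero_cancel, rule Lim_null_comparison[OF _ assms(3)])
  show "\<forall>\<^sub>F k in sequentially. norm (u k j - v j) \<le> hnorm (u k - v)"
    using norm_coord_le_hnorm[of "u _ - v" n j] assms(1,2) by simp
qed

section \<open>Expansions in the standard basis\<close>

text \<open>The vanishing of \<open>std_basis n i\<close> for \<open>i \<ge> n\<close> lets all sums run over \<open>{..<N}\<close>.\<close>

definition std_basis :: "enat \<Rightarrow> nat \<Rightarrow> vec"
  where "std_basis n i = (\<lambda>j. if j = i \<and> enat i < n then 1 else 0)"

lemma std_basis_hilb [simp]: "std_basis n i \<in> hilb n"
proof -
  have "summable (\<lambda>j. (cmod (std_basis n i j))\<^sup>2)"
    by (rule summable_finite[of "{i}"]) (auto simp: std_basis_def)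
  then show ?thesis
    by (auto simp: hilb_def std_basis_def)
qed

lemma sum_std_basis:
  assumes "v \<in> hilb n"
  shows "(\<Sum>i<N. hscale (v i) (std_basis n i)) = (\<lambda>j. if j < N then v j else 0)"
proof
  fix j
  have "(\<Sum>i<N. hscale (v i) (std_basis n i)) j = (\<Sum>i<N. if i = j then v i * of_bool (enat i < n) else 0)"
    unfolding sum_vec_apply by (rule sum.cong) (auto simp: hscale_def std_basis_def)
  also have "\<dots> = (if j < N then v j else 0)"
    using assms by (auto simp: hilb_def not_less)
  finally show "(\<Sum>i<N. hscale (v i) (std_basis n i)) j = (if j < N then v j else 0)" .
qed

lemma hnorm_sq_tail:
  assumes "v \<in> hilb n"
  shows "(hnorm (v - (\<Sum>i<N. hscale (v i) (std_basis n i))))\<^sup>2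
    = (\<Sum>i. (cmod (v (i + N)))\<^sup>2)"
proof -
  let ?d = "v - (\<Sum>i<N. hscale (v i) (std_basis n i))"
  have d: "?d \<in> hilb n"
    using assms by (intro hilb_diff hilb_sum) auto
  have "(hnorm ?d)\<^sup>2 = (\<Sum>i. (cmod (?d i))\<^sup>2)"
    by (rule hnorm_sq[OF d])
  also have "\<dots> = (\<Sum>i. (cmod (?d (i + N)))\<^sup>2) + (\<Sum>i<N. (cmod (?d i))\<^sup>2)"
    by (rule suminf_split_initial_segment[OF summable_hilb[OF d]])
  also have "\<dots> = (\<Sum>i. (cmod (v (i + N)))\<^sup>2)"
    by (simp add: sum_std_basis[OF assms])
  finally show ?thesis .
qed

lemma std_basis_expansion:
  assumes "v \<in> hilb n"
  shows "(\<lambda>N. hnorm (v - (\<Sum>i<N. hscale (v i) (std_basis n i)))) \<longlonglongrightarrow> 0"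
proof -
  have "(\<lambda>N. \<Sum>i. (cmod (v (i + N)))\<^sup>2) \<longlonglongrightarrow> 0"
    by (rule suminf_exist_split2[OF summable_hilb[OF assms]])
  then have "(\<lambda>N. sqrt (\<Sum>i. (cmod (v (i + N)))\<^sup>2)) \<longlonglongrightarrow> sqrt 0"
    by (rule tendsto_real_sqrt)
  moreover have "0 \<le> hnorm (v - (\<Sum>i<N. hscale (v i) (std_basis n i)))" for N
    using assms by (intro hnorm_nonneg[of _ n] hilb_diff hilb_sum) auto
  ultimately show ?thesis
    by (simp add: hnorm_sq_tail[OF assms, symmetric])
qed

text \<open>Continuity of a fibre norm in finitely many coefficients. It carries identities from
  rational coefficients to arbitrary complex ones.\<close>

lemma tendsto_combination:
  assumes G: "\<And>i. G i \<in> hilb n" and u: "u \<in> hilb n"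
    and b: "\<And>i. (\<lambda>k. b k i) \<longlonglongrightarrow> a i"
  shows "(\<lambda>k. hnorm (u - (\<Sum>i<N. hscale (b k i) (G i))))
    \<longlonglongrightarrow> hnorm (u - (\<Sum>i<N. hscale (a i) (G i)))"
proof (rule tendsto_hnorm)
  show "u - (\<Sum>i<N. hscale (a i) (G i)) \<in> hilb n" "u - (\<Sum>i<N. hscale (b k i) (G i)) \<in> hilb n" for k
    using u G by (auto intro!: hilb_diff hilb_sum)
  \<comment> \<open>The limit is written with \<open>a i - a i\<close>, that is 0, so that it has
    the shape produced by the continuity rules.\<close>
  have lim: "(\<lambda>k. \<Sum>i<N. cmod (a i - b k i) * hnorm (G i)) \<longlonglongrightarrow> (\<Sum>i<N. cmod (a i - a i) * hnorm (G i))"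
    by (intro tendsto_intros b)
  show "(\<lambda>k. hnorm (u - (\<Sum>i<N. hscale (b k i) (G i)) - (u - (\<Sum>i<N. hscale (a i) (G i))))) \<longlonglongrightarrow> 0"
  proof (rule Lim_null_comparison)
    show "\<forall>\<^sub>F k in sequentially.
        norm (hnorm (u - (\<Sum>i<N. hscale (b k i) (G i)) - (u - (\<Sum>i<N. hscale (a i) (G i)))))
        \<le> (\<Sum>i<N. cmod (a i - b k i) * hnorm (G i))"
    proof (rule always_eventually, rule allI)
      fix k
      have eq: "u - (\<Sum>i<N. hscale (b k i) (G i)) - (u - (\<Sum>i<N. hscale (a i) (G i)))
          = (\<Sum>i<N. hscale (a i - b k i) (G i))"
        by (simp add: fun_eq_iff sum_vec_apply hscale_def algebra_simps sum_subtractf)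
      have "hnorm (\<Sum>i<N. hscale (a i - b k i) (G i)) \<le> (\<Sum>i<N. hnorm (hscale (a i - b k i) (G i)))"
        by (rule hnorm_sum_le[of _ _ n]) (use G in auto)
      also have "\<dots> = (\<Sum>i<N. cmod (a i - b k i) * hnorm (G i))"
        by (intro sum.cong refl hnorm_hscale[OF G])
      finally show "norm (hnorm (u - (\<Sum>i<N. hscale (b k i) (G i)) - (u - (\<Sum>i<N. hscale (a i) (G i)))))
          \<le> (\<Sum>i<N. cmod (a i - b k i) * hnorm (G i))"
        unfolding eq using hnorm_nonneg[of "\<Sum>i<N. hscale (a i - b k i) (G i)" n] G
        by (simp add: hilb_sum)
    qed
    show "(\<lambda>k. \<Sum>i<N. cmod (a i - b k i) * hnorm (G i)) \<longlonglongrightarrow> 0"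
      using lim by simp
  qed
qed

section \<open>Semilinear isometries of the model spaces\<close>

definition semilinear_isometry :: "(complex \<Rightarrow> complex) \<Rightarrow> vec set \<Rightarrow> vec set \<Rightarrow> (vec \<Rightarrow> vec) \<Rightarrow> bool"
  where "semilinear_isometry \<sigma> H K T \<longleftrightarrow>
    T ` H \<subseteq> K \<and>
    (\<forall>v\<in>H. \<forall>w\<in>H. T (v + w) = T v + T w) \<and>
    (\<forall>a. \<forall>v\<in>H. T (hscale a v) = hscale (\<sigma> a) (T v)) \<and>
    (\<forall>v\<in>H. hnorm (T v) = hnorm v)"

lemma antilinear_isometry_iff:
  "antilinear_isometry_between H K T \<longleftrightarrow> semilinear_isometry cnj H K T"
  by (simp add: antilinear_isometry_between_def semilinear_isometry_def)

lemma semilinear_isometryD: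
  assumes "semilinear_isometry \<sigma> H K T"
  shows "v \<in> H \<Longrightarrow> T v \<in> K"
    and "v \<in> H \<Longrightarrow> w \<in> H \<Longrightarrow> T (v + w) = T v + T w"
    and "v \<in> H \<Longrightarrow> T (hscale a v) = hscale (\<sigma> a) (T v)"
    and "v \<in> H \<Longrightarrow> hnorm (T v) = hnorm v"
  using assms by (auto simp: semilinear_isometry_def)

text \<open>The map on scalars is a parameter, \<open>id\<close> for the coefficients
  \<open>c\<close> and \<open>cnj\<close> for \<open>q\<close>, because products of both kinds occur
  and two antilinear maps compose to a linear one.\<close>

lemma semilinear_isometry_comp:
  assumes "semilinear_isometry \<sigma> H K S" "semilinear_isometry \<tau> K L T"
  shows "semilinear_isometry (\<lambda>a. \<tau> (\<sigma> a)) H L (\<lambda>v. T (S v))"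
  unfolding semilinear_isometry_def
  using semilinear_isometryD[OF assms(1)] semilinear_isometryD[OF assms(2)] by auto

lemma semilinear_isometry_zero:
  assumes "semilinear_isometry \<sigma> (hilb n) (hilb m) T"
  shows "T 0 = 0"
proof (rule hnorm_eq_0D)
  show "T 0 \<in> hilb m" "hnorm (T 0) = 0"
    using semilinear_isometryD(1,4)[OF assms zero_in_hilb] by auto
qed

lemma semilinear_isometry_hscale:
  assumes "semilinear_isometry \<sigma> (hilb n) (hilb m) T" "cmod a = 1"
  shows "semilinear_isometry \<sigma> (hilb n) (hilb m) (\<lambda>v. hscale a (T v))"
  unfolding semilinear_isometry_def
proof (intro conjI ballI allI subsetI)
  note T = semilinear_isometryD[OF assms(1)]
  show "w \<in> hilb m" if "w \<in> (\<lambda>v. hscale a (T v)) ` hilb n" for w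
    using that T(1) by auto
  show "hscale a (T (v + w)) = hscale a (T v) + hscale a (T w)" if "v \<in> hilb n" "w \<in> hilb n" for v w
    using T(2)[OF that] by (simp only: hscale_add)
  show "hscale a (T (hscale b v)) = hscale (\<sigma> b) (hscale a (T v))" if "v \<in> hilb n" for b v
    using T(3)[OF that] by (simp add: mult.commute)
  show "hnorm (hscale a (T v)) = hnorm v" if "v \<in> hilb n" for v
    using hnorm_hscale[OF T(1)[OF that], of a] T(4)[OF that] assms(2) by simp
qed

text \<open>Isometries are continuous and finite combinations of basis vectors are dense. An
  operator identity in a fibre thus reduces to countably many vectors, which is what allows one null
  set to serve for all vectors of the fibre.\<close>

lemma semilinear_isometry_eqI:
  assumes A: "semilinear_isometry \<sigma> (hilb n) (hilb m) A"
    and B: "semilinear_isometry \<sigma> (hilb n) (hilb m) B"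
    and basis: "\<And>i. A (std_basis n i) = B (std_basis n i)"
    and v: "v \<in> hilb n"
  shows "A v = B v"
proof -
  define s where "s N = (\<Sum>i<N. hscale (v i) (std_basis n i))" for N
  have s: "s N \<in> hilb n" for N
    unfolding s_def by (intro hilb_sum hilb_hscale std_basis_hilb)
  have AB: "A (s N) = B (s N)" for N
  proof (induction N)
    case 0
    show ?case
      unfolding s_def lessThan_0 sum.empty
        semilinear_isometry_zero[OF A] semilinear_isometry_zero[OF B] ..
  next
    case (Suc N)
    have "s (Suc N) = s N + hscale (v N) (std_basis n N)"
      by (simp add: s_def lessThan_Suc add.commute)
    moreover have "T (s N + hscale (v N) (std_basis n N)) = T (s N) + hscale (\<sigma> (v N)) (T (std_basis n N))"
      if "semilinear_isometry \<sigma> (hilb n) (hilb m) T" for T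
      using semilinear_isometryD(2)[OF that s hilb_hscale[OF std_basis_hilb]]
        semilinear_isometryD(3)[OF that std_basis_hilb] by metis
    ultimately show ?case
      using A B Suc basis[of N] by metis
  qed
  have lim: "(\<lambda>N. T (s N) j) \<longlonglongrightarrow> T v j" if T: "semilinear_isometry \<sigma> (hilb n) (hilb m) T" for T j
  proof (rule tendsto_hnorm_coord)
    show "T v \<in> hilb m" "T (s N) \<in> hilb m" for N
      using semilinear_isometryD(1)[OF T] v s by blast+
    have "hnorm (T (s N) - T v) = hnorm (v - s N)" for N
    proof -
      \<comment> \<open>Additivity is available for sums only, so the difference is produced by
        splitting off \<open>v\<close>.\<close>
      have "T (s N) = T ((s N - v) + v)"
        by simp
      also have "\<dots> = T (s N - v) + T v"
        by (intro semilinear_isometryD(2)[OF T] hilb_diff s v)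
      finally have "hnorm (T (s N) - T v) = hnorm (T (s N - v))"
        by simp
      also have "\<dots> = hnorm (s N - v)"
        by (intro semilinear_isometryD(4)[OF T] hilb_diff s v)
      finally show ?thesis
        using hnorm_diff_commute[OF s v] by simp
    qed
    then show "(\<lambda>N. hnorm (T (s N) - T v)) \<longlonglongrightarrow> 0"
      using std_basis_expansion[OF v] by (simp add: s_def)
  qed
  show ?thesis
    by (rule ext, rule LIMSEQ_unique[OF lim[OF A]]) (simp add: AB lim[OF B])
qed

section \<open>Inner products, unitaries and adjoints\<close>

lemma hinner_self: "v \<in> hilb n \<Longrightarrow> hinner v v = of_real ((hnorm v)\<^sup>2)"
  using suminf_of_real[OF summable_hilb, of v n, where 'a = complex]
  by (simp add: hinner_def hnorm_sq complex_norm_square[symmetric])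

lemma hinner_std_basis: "hinner (std_basis n i) w = (if enat i < n then cnj (w i) else 0)"
proof -
  have "(\<Sum>j. std_basis n i j * cnj (w j)) = (\<Sum>j\<in>{i}. std_basis n i j * cnj (w j))"
    by (rule suminf_finite) (auto simp: std_basis_def)
  then show ?thesis
    by (simp add: hinner_def std_basis_def)
qed

lemma unitary_isometry:
  assumes "unitary_between (hilb n) (hilb m) T"
  shows "semilinear_isometry id (hilb n) (hilb m) T"
proof -
  have in_m: "v \<in> hilb n \<Longrightarrow> T v \<in> hilb m" for v
    using assms by (auto simp: unitary_between_def)
  have "hnorm (T v) = hnorm v" if v: "v \<in> hilb n" for v
  proof -
    have "hinner (T v) (T v) = hinner v v"
      using assms v by (auto simp: unitary_between_def)
    then have "(hnorm (T v))\<^sup>2 = (hnorm v)\<^sup>2"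
      unfolding hinner_self[OF in_m[OF v]] hinner_self[OF v] of_real_eq_iff .
    then show ?thesis
      using hnorm_nonneg[OF in_m[OF v]] hnorm_nonneg[OF v] by (simp add: power2_eq_iff_nonneg)
  qed
  then show ?thesis
    using assms in_m by (auto simp: semilinear_isometry_def unitary_between_def)
qed

text \<open>Surjectivity writes \<open>w\<close> as \<open>T u\<close>. Testing against the standard
  basis then identifies \<open>S w\<close> with \<open>u\<close>: inner products recover the
  coordinates below \<open>n\<close>, and all others vanish.\<close>

lemma unitary_adjoint_right_inverse:
  assumes T: "unitary_between (hilb n) (hilb m) T" and S: "adjoint_between (hilb n) (hilb m) T S"
    and w: "w \<in> hilb m"
  shows "T (S w) = w"
proof -
  have "T ` hilb n = hilb m"
    using T by (simp add: unitary_between_def)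
  then obtain u where u: "u \<in> hilb n" "w = T u"
    using w by (metis imageE)
  have Sw: "S w \<in> hilb n"
    using S w by (auto simp: adjoint_between_def)
  have "hinner v u = hinner v (S w)" if "v \<in> hilb n" for v
  proof -
    have "hinner v u = hinner (T v) (T u)"
      using T u(1) that by (simp add: unitary_between_def)
    also have "\<dots> = hinner v (S w)"
      using S u(2) w that by (simp add: adjoint_between_def)
    finally show ?thesis .
  qed
  then have "hinner (std_basis n i) u = hinner (std_basis n i) (S w)" for i
    using std_basis_hilb by blast
  then have "u i = S w i" if "enat i < n" for i
    using that by (metis hinner_std_basis complex_cnj_cancel_iff)
  moreover have "\<not> enat i < n \<Longrightarrow> u i = S w i" for i
    using u(1) Sw by (auto simp: hilb_def not_less)
  ultimately have "u = S w"
    by blast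
  then show ?thesis
    using u(2) by simp
qed

text \<open>Indices from \<open>n\<close> on contribute nothing because the basis vector is zero
  there. This is the right-hand side that the images of the basis have to reproduce.\<close>

lemma hnorm_sq_std_combination:
  "(hnorm (\<Sum>i<N. hscale (a i) (std_basis n i)))\<^sup>2 = (\<Sum>i<N. if enat i < n then (cmod (a i))\<^sup>2 else 0)"
proof -
  let ?v = "\<Sum>i<N. hscale (a i) (std_basis n i)"
  have coord: "?v j = (if j < N \<and> enat j < n then a j else 0)" for j
  proof -
    have "?v j = (\<Sum>i<N. if i = j then (if enat j < n then a j else 0) else 0)"
      unfolding sum_vec_apply by (rule sum.cong) (auto simp: hscale_def std_basis_def)
    then show ?thesis
      by simp
  qed
  have "?v \<in> hilb n"
    by (intro hilb_sum hilb_hscale std_basis_hilb)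
  then have "(hnorm ?v)\<^sup>2 = (\<Sum>j. (cmod (?v j))\<^sup>2)"
    by (rule hnorm_sq)
  also have "\<dots> = (\<Sum>j\<in>{..<N}. (cmod (?v j))\<^sup>2)"
    by (rule suminf_finite) (auto simp: coord)
  also have "\<dots> = (\<Sum>i<N. if enat i < n then (cmod (a i))\<^sup>2 else 0)"
    by (rule sum.cong) (auto simp: coord)
  finally show ?thesis .
qed

section \<open>Antilinear extension of an orthonormal family\<close>

definition antilinear_ext :: "(nat \<Rightarrow> vec) \<Rightarrow> vec \<Rightarrow> vec"
  where "antilinear_ext H v = (\<lambda>j. \<Sum>i. cnj (v i) * H i j)"

text \<open>The identity for all finite combinations says, by polarisation, that the
  \<open>H i\<close> with \<open>i < n\<close> are orthonormal and the others vanish. It is phrased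
  through norms because norms are what the quaternionic structure is shown to transport.\<close>

locale orthonormal_images =
  fixes H :: "nat \<Rightarrow> vec" and n m :: enat
  assumes H: "\<And>i. H i \<in> hilb m"
    and norm_combination: "\<And>N a. (hnorm (\<Sum>i<N. hscale (a i) (H i)))\<^sup>2
      = (\<Sum>i<N. if enat i < n then (cmod (a i))\<^sup>2 else 0)"
begin

definition partial :: "vec \<Rightarrow> nat \<Rightarrow> vec"
  where "partial v N = (\<Sum>i<N. hscale (cnj (v i)) (H i))"

lemma partial_hilb: "partial v N \<in> hilb m"
  unfolding partial_def by (intro hilb_sum hilb_hscale H)

lemma hnorm_partial_diff:
  assumes "v \<in> hilb n" "N \<le> M"
  shows "(hnorm (partial v M - partial v N))\<^sup>2 = (\<Sum>i\<in>{N..<M}. (cmod (v i))\<^sup>2)"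
proof -
  have split: "{..<M} = {..<N} \<union> {N..<M}" "{..<N} \<inter> {N..<M} = {}"
    using assms(2) by auto
  have "partial v M - partial v N = (\<Sum>i\<in>{N..<M}. hscale (cnj (v i)) (H i))"
    unfolding partial_def split(1) by (subst sum.union_disjoint) (auto simp: split)
  \<comment> \<open>Padding with zero coefficients turns a block of indices into an initial segment,
    the only shape covered by \<open>norm_combination\<close>.\<close>
  also have "\<dots> = (\<Sum>i<M. hscale (if i < N then 0 else cnj (v i)) (H i))"
    unfolding split(1) by (subst sum.union_disjoint) auto
  finally have "(hnorm (partial v M - partial v N))\<^sup>2
      = (\<Sum>i<M. if enat i < n then (cmod (if i < N then 0 else cnj (v i)))\<^sup>2 else 0)"
    by (simp only: norm_combination)
  also have "\<dots> = (\<Sum>i<M. if i < N then 0 else (cmod (v i))\<^sup>2)"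
    using assms(1) by (intro sum.cong) (auto simp: hilb_def not_less)
  also have "\<dots> = (\<Sum>i\<in>{N..<M}. (cmod (v i))\<^sup>2)"
    unfolding split(1) by (subst sum.union_disjoint) auto
  finally show ?thesis .
qed

lemma partial_tail:
  assumes "v \<in> hilb n" "N \<le> M"
  shows "(hnorm (partial v M - partial v N))\<^sup>2 \<le> (\<Sum>i. (cmod (v (i + N)))\<^sup>2)"
proof -
  have s: "summable (\<lambda>i. (cmod (v (i + N)))\<^sup>2)"
    using summable_hilb[OF assms(1)] summable_iff_shift[of "\<lambda>i. (cmod (v i))\<^sup>2" N] by blast
  have "(\<Sum>i\<in>{N..<M}. (cmod (v i))\<^sup>2) = (\<Sum>i<M - N. (cmod (v (i + N)))\<^sup>2)"
    by (rule sum.reindex_bij_witness[of _ "\<lambda>i. i + N" "\<lambda>i. i - N"]) auto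
  also have "\<dots> \<le> (\<Sum>i. (cmod (v (i + N)))\<^sup>2)"
    by (rule sum_le_suminf[OF s]) auto
  finally show ?thesis
    using hnorm_partial_diff[OF assms] by simp
qed

lemma tail_tendsto_0: "v \<in> hilb n \<Longrightarrow> (\<lambda>N. \<Sum>i. (cmod (v (i + N)))\<^sup>2) \<longlonglongrightarrow> 0"
  by (rule suminf_exist_split2[OF summable_hilb])

text \<open>The partial sums are Cauchy in norm since the tails of \<open>v\<close> are small, and
  each coordinate is dominated by the norm.\<close>

lemma antilinear_ext_sums:
  assumes v: "v \<in> hilb n"
  shows "(\<lambda>i. cnj (v i) * H i j) sums antilinear_ext H v j"
proof -
  have partial_apply: "(\<Sum>i<N. cnj (v i) * H i j) = partial v N j" for N
    by (simp add: partial_def sum_vec_apply hscale_def)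
  have "Cauchy (\<lambda>N. partial v N j)"
  proof (rule metric_CauchyI)
    fix e :: real assume e: "0 < e"
    then have "0 < (e/2)\<^sup>2"
      by simp
    then obtain K where K: "\<And>N. N \<ge> K \<Longrightarrow> (\<Sum>i. (cmod (v (i + N)))\<^sup>2) < (e/2)\<^sup>2"
      using order_tendstoD(2)[OF tail_tendsto_0[OF v]] unfolding eventually_sequentially by blast
    have "dist (partial v M j) (partial v K j) < e/2" if "M \<ge> K" for M
    proof -
      have "cmod ((partial v M - partial v K) j) \<le> hnorm (partial v M - partial v K)"
        by (rule norm_coord_le_hnorm[OF hilb_diff[OF partial_hilb partial_hilb]])
      also have "\<dots> < e/2"
      proof (rule power2_less_imp_less)
        show "(hnorm (partial v M - partial v K))\<^sup>2 < (e/2)\<^sup>2"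
          using partial_tail[OF v that] K[of K] by simp
      qed (use e in simp)
      finally show ?thesis
        by (simp add: dist_norm)
    qed
    then show "\<exists>K. \<forall>M\<ge>K. \<forall>N\<ge>K. dist (partial v M j) (partial v N j) < e"
      using dist_triangle_half_l by (intro exI[of _ K] allI impI) blast
  qed
  then have "convergent (\<lambda>N. partial v N j)"
    by (rule Cauchy_convergent)
  then have "summable (\<lambda>i. cnj (v i) * H i j)"
    unfolding summable_iff_convergent by (simp add: partial_apply)
  then show ?thesis
    unfolding antilinear_ext_def by (rule summable_sums)
qed

lemma partial_tendsto_coord: "v \<in> hilb n \<Longrightarrow> (\<lambda>N. partial v N j) \<longlonglongrightarrow> antilinear_ext H v j"
  using antilinear_ext_sums[of v j] unfolding sums_def
  by (simp add: partial_def sum_vec_apply hscale_def)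

text \<open>An argument of Fatou type: for finitely many coordinates the tail bound survives the
  limit of the partial sums, and it does not depend on how many coordinates are taken. The case
  \<open>N = 0\<close> gives membership of the extension itself.\<close>

lemma antilinear_ext_partial:
  assumes v: "v \<in> hilb n"
  shows "antilinear_ext H v - partial v N \<in> hilb m"
    and "(hnorm (antilinear_ext H v - partial v N))\<^sup>2 \<le> (\<Sum>i. (cmod (v (i + N)))\<^sup>2)"
proof -
  let ?d = "antilinear_ext H v - partial v N"
  have bound: "(\<Sum>j<K. (cmod (?d j))\<^sup>2) \<le> (\<Sum>i. (cmod (v (i + N)))\<^sup>2)" for K
  proof (rule LIMSEQ_le_const2)
    show "(\<lambda>M. \<Sum>j<K. (cmod ((partial v M - partial v N) j))\<^sup>2) \<longlonglongrightarrow> (\<Sum>j<K. (cmod (?d j))\<^sup>2)"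
      by (auto intro!: tendsto_intros partial_tendsto_coord[OF v])
    have "(\<Sum>j<K. (cmod ((partial v M - partial v N) j))\<^sup>2) \<le> (\<Sum>i. (cmod (v (i + N)))\<^sup>2)" if "M \<ge> N" for M
      using sum_le_hnorm_sq[of "partial v M - partial v N" m K] partial_tail[OF v that]
        partial_hilb[of v M] partial_hilb[of v N] by (meson hilb_diff order_trans)
    then show "\<exists>M0. \<forall>M\<ge>M0. (\<Sum>j<K. (cmod ((partial v M - partial v N) j))\<^sup>2)
        \<le> (\<Sum>i. (cmod (v (i + N)))\<^sup>2)"
      by blast
  qed
  have "antilinear_ext H v i = 0" if "m \<le> enat i" for i
  proof -
    have "partial v M i = 0" for M
      using partial_hilb[of v M] that by (auto simp: hilb_def)
    then show ?thesis
      using partial_tendsto_coord[OF v, of i] by (simp add: LIMSEQ_const_iff)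
  qed
  then have "?d i = 0" if "m \<le> enat i" for i
    using partial_hilb[of v N] that by (auto simp: hilb_def)
  then show "?d \<in> hilb m"
    using hilb_infI_bounded(1)[of ?d, OF bound] hilb_iff[of ?d m] by blast
  show "(hnorm ?d)\<^sup>2 \<le> (\<Sum>i. (cmod (v (i + N)))\<^sup>2)"
    by (rule hilb_infI_bounded(2)[of ?d, OF bound])
qed

lemma antilinear_ext_hilb: "v \<in> hilb n \<Longrightarrow> antilinear_ext H v \<in> hilb m"
  using hilb_add[OF antilinear_ext_partial(1)[of v 0] partial_hilb[of v 0]] by simp

text \<open>The partial sums converge in norm to the extension, while their squared norms are the
  partial sums of the series for the squared norm of \<open>v\<close>.\<close>

lemma hnorm_antilinear_ext:
  assumes v: "v \<in> hilb n"
  shows "hnorm (antilinear_ext H v) = hnorm v"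
proof -
  have sq: "(\<lambda>N. (hnorm (partial v N))\<^sup>2) \<longlonglongrightarrow> (hnorm v)\<^sup>2"
  proof -
    have "(hnorm (partial v N))\<^sup>2 = (\<Sum>i<N. (cmod (v i))\<^sup>2)" for N
      using hnorm_partial_diff[OF v, of 0 N] by (simp add: partial_def atLeast0LessThan)
    then show ?thesis
      using summable_LIMSEQ[OF summable_hilb[OF v]] by (simp add: hnorm_sq[OF v])
  qed
  have "(\<lambda>N. sqrt (\<Sum>i. (cmod (v (i + N)))\<^sup>2)) \<longlonglongrightarrow> sqrt 0"
    by (rule tendsto_real_sqrt[OF tail_tendsto_0[OF v]])
  moreover have "norm (hnorm (partial v N - antilinear_ext H v)) \<le> sqrt (\<Sum>i. (cmod (v (i + N)))\<^sup>2)" for N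
    using antilinear_ext_partial[OF v, of N] hnorm_nonneg[OF antilinear_ext_partial(1)[OF v, of N]]
      hnorm_diff_commute[OF partial_hilb antilinear_ext_hilb[OF v], of v N]
    by (simp add: real_le_rsqrt)
  ultimately have "(\<lambda>N. hnorm (partial v N - antilinear_ext H v)) \<longlonglongrightarrow> 0"
    using Lim_null_comparison[of "\<lambda>N. hnorm (partial v N - antilinear_ext H v)"
        "\<lambda>N. sqrt (\<Sum>i. (cmod (v (i + N)))\<^sup>2)" sequentially] by simp
  then have "(\<lambda>N. hnorm (partial v N)) \<longlonglongrightarrow> hnorm (antilinear_ext H v)"
    by (rule tendsto_hnorm[OF antilinear_ext_hilb[OF v] partial_hilb])
  then have "(\<lambda>N. (hnorm (partial v N))\<^sup>2) \<longlonglongrightarrow> (hnorm (antilinear_ext H v))\<^sup>2"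
    by (rule tendsto_power)
  then have "(hnorm (antilinear_ext H v))\<^sup>2 = (hnorm v)\<^sup>2"
    using sq by (rule LIMSEQ_unique)
  then show ?thesis
    using hnorm_nonneg[OF v] hnorm_nonneg[OF antilinear_ext_hilb[OF v]]
    by (simp add: power2_eq_iff_nonneg)
qed

lemma semilinear_isometry_ext: "semilinear_isometry cnj (hilb n) (hilb m) (antilinear_ext H)"
  unfolding semilinear_isometry_def
proof (intro conjI ballI allI subsetI)
  fix w assume "w \<in> antilinear_ext H ` hilb n"
  then show "w \<in> hilb m"
    using antilinear_ext_hilb by auto
next
  fix v w assume v: "v \<in> hilb n" and w: "w \<in> hilb n"
  show "antilinear_ext H (v + w) = antilinear_ext H v + antilinear_ext H w"
  proof
    fix j
    have "(\<lambda>i. cnj (v i) * H i j + cnj (w i) * H i j) sums (antilinear_ext H v j + antilinear_ext H w j)"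
      by (intro sums_add antilinear_ext_sums v w)
    then show "antilinear_ext H (v + w) j = (antilinear_ext H v + antilinear_ext H w) j"
      using antilinear_ext_sums[OF hilb_add[OF v w], of j] by (simp add: algebra_simps sums_iff)
  qed
next
  fix a v assume v: "v \<in> hilb n"
  show "antilinear_ext H (hscale a v) = hscale (cnj a) (antilinear_ext H v)"
  proof
    fix j
    have "(\<lambda>i. cnj a * (cnj (v i) * H i j)) sums (cnj a * antilinear_ext H v j)"
      by (intro sums_mult antilinear_ext_sums v)
    then show "antilinear_ext H (hscale a v) j = hscale (cnj a) (antilinear_ext H v) j"
      using antilinear_ext_sums[OF hilb_hscale[OF v], of a j]
      by (simp add: algebra_simps sums_iff hscale_def)
  qed
qed (rule hnorm_antilinear_ext)

end

section \<open>Comparison of dimensions\<close>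

lemma ex_nontrivial_relation:
  fixes h :: "nat \<Rightarrow> nat \<Rightarrow> complex"
  shows "\<exists>a. (\<exists>i\<le>m. a i \<noteq> 0) \<and> (\<forall>j<m. (\<Sum>i\<le>m. a i * h i j) = 0)"
\<comment> \<open>Gaussian elimination for \<open>m + 1\<close> vectors with \<open>m\<close>
  coordinates: a pivot clears the last coordinate and the induction hypothesis treats what
  remains.\<close>
proof (induction m arbitrary: h)
  case 0
  show ?case
    by (rule exI[of _ "\<lambda>_. 1"]) auto
next
  case (Suc m)
  show ?case
  proof (cases "\<forall>i\<le>Suc m. h i m = 0")
    case True
    obtain a where a: "\<exists>i\<le>m. a i \<noteq> 0" "\<forall>j<m. (\<Sum>i\<le>m. a i * h i j) = 0"
      using Suc by blast
    \<comment> \<open>With the last coordinate zero throughout, a relation among all vectors but the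
      last one suffices.\<close>
    let ?b = "\<lambda>i. if i \<le> m then a i else 0"
    have "(\<Sum>i\<le>Suc m. ?b i * h i j) = (\<Sum>i\<le>m. a i * h i j)" for j
      by simp
    moreover have "(\<Sum>i\<le>m. a i * h i m) = 0"
      using True by (intro sum.neutral) auto
    ultimately have "\<forall>j<Suc m. (\<Sum>i\<le>Suc m. ?b i * h i j) = 0"
      using a(2) by (metis less_antisym)
    then show ?thesis
      using a(1) by (intro exI[of _ ?b]) (auto intro: le_SucI)
  next
    case False
    then obtain p where p: "p \<le> Suc m" "h p m \<noteq> 0"
      by blast
    \<comment> \<open>\<open>s\<close> enumerates the indices other than the pivot \<open>p\<close>;
      \<open>t\<close> below undoes it.\<close>
    define s where "s i = (if i < p then i else Suc i)" for i
    have s: "bij_betw s {..m} ({..Suc m} - {p})"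
      by (rule bij_betw_byWitness[where f' = "\<lambda>i. if i < p then i else i - 1"])
        (use p in \<open>auto simp: s_def\<close>)
    obtain a where a: "\<exists>i\<le>m. a i \<noteq> 0"
      "\<forall>j<m. (\<Sum>i\<le>m. a i * (h (s i) j - h (s i) m / h p m * h p j)) = 0"
      using Suc[of "\<lambda>i j. h (s i) j - h (s i) m / h p m * h p j"] by blast
    define t where "t i = (if i < p then i else i - 1)" for i
    have ts: "t (s i) = i" "s i \<noteq> p" for i
      by (auto simp: t_def s_def)
    \<comment> \<open>The coefficient of the pivot collects the multiples of it that were subtracted
      from the other vectors.\<close>
    define b where "b i = (if i = p then - (\<Sum>i\<le>m. a i * h (s i) m / h p m) else a (t i))" for i
    have sum_b: "(\<Sum>i\<le>Suc m. b i * h i j) = (\<Sum>i\<le>m. a i * (h (s i) j - h (s i) m / h p m * h p j))" for j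
    proof -
      have "(\<Sum>i\<le>Suc m. b i * h i j) = b p * h p j + (\<Sum>i\<in>{..Suc m} - {p}. b i * h i j)"
        by (rule sum.remove) (use p in auto)
      also have "(\<Sum>i\<in>{..Suc m} - {p}. b i * h i j) = (\<Sum>i\<le>m. a i * h (s i) j)"
        using sum.reindex_bij_betw[OF s, of "\<lambda>i. b i * h i j"] by (simp add: b_def ts)
      finally show ?thesis
        by (simp add: b_def algebra_simps sum_distrib_left sum_subtractf)
    qed
    have "(\<Sum>i\<le>Suc m. b i * h i j) = 0" if "j < Suc m" for j
    proof (cases "j = m")
      case True
      then show ?thesis
        unfolding sum_b using p(2) by simp
    next
      case False
      then show ?thesis
        unfolding sum_b using a(2) that by simp
    qed
    moreover obtain i where "i \<le> m" "a i \<noteq> 0"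
      using a(1) by blast
    moreover have "b (s i) = a i" for i
      by (simp add: b_def ts)
    moreover have "s i \<le> Suc m" if "i \<le> m" for i
      using that by (auto simp: s_def)
    ultimately show ?thesis
      by (intro exI[of _ b]) metis
  qed
qed

text \<open>If \<open>m = k\<close> were finite and smaller than \<open>n\<close>, the
  \<open>k + 1\<close> vectors \<open>H 0, ..., H k\<close> would satisfy a nontrivial relation, but
  the norm identity forces all its coefficients to vanish.\<close>

lemma (in orthonormal_images) dimension_le: "n \<le> m"
proof (rule ccontr)
  assume "\<not> n \<le> m"
  then have mn: "m < n"
    by simp
  then obtain k where k: "m = enat k"
    by (cases m) auto
  obtain a where a: "\<exists>i\<le>k. a i \<noteq> 0" "\<forall>j<k. (\<Sum>i\<le>k. a i * H i j) = 0"
    using ex_nontrivial_relation[of k H] by blast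
  have "(\<Sum>i<Suc k. hscale (a i) (H i)) j = 0" for j
  proof (cases "j < k")
    case True
    then show ?thesis
      using a(2) unfolding sum_vec_apply hscale_def lessThan_Suc_atMost by blast
  next
    case False
    then have "H i j = 0" for i
      using H[of i] k by (auto simp: hilb_def)
    then show ?thesis
      by (simp add: sum_vec_apply hscale_def)
  qed
  then have "(\<Sum>i<Suc k. hscale (a i) (H i)) = 0"
    by (auto simp only: fun_eq_iff zero_fun_apply)
  then have "(\<Sum>i<Suc k. if enat i < n then (cmod (a i))\<^sup>2 else 0) = 0"
    using norm_combination[of a "Suc k"] by simp
  moreover have "enat i < n" if "i < Suc k" for i
    using that mn k by (metis enat_ord_simps(1) less_Suc_eq_le order_le_less_trans)
  ultimately have "(\<Sum>i<Suc k. (cmod (a i))\<^sup>2) = 0"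
    by simp
  then have "\<forall>i<Suc k. a i = 0"
    by (subst (asm) sum_nonneg_eq_0_iff) auto
  then show False
    using a(1) by auto
qed

section \<open>Nonsingular involutions of a sigma-finite measure space\<close>

locale nonsingular_involution = sigma_finite_measure M for M :: "'a measure" +
  fixes \<phi> :: "'a \<Rightarrow> 'a"
  assumes measurable_inv [measurable]: "\<phi> \<in> measurable M M"
    and invol [simp]: "\<And>x. \<phi> (\<phi> x) = x"
    and equivalent: "equivalent_measures (distr M M \<phi>) M"
begin

definition \<rho> :: "'a \<Rightarrow> ennreal"
  where "\<rho> = RN_deriv M (distr M M \<phi>)"

text \<open>\<open>enn2real\<close> turns an infinite density into 0; \<open>r_facts\<close> shows
  that neither value matters outside a null set.\<close>

definition r :: "'a \<Rightarrow> real"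
  where "r x = sqrt (enn2real (\<rho> x))"

lemma rho_measurable [measurable]: "\<rho> \<in> borel_measurable M"
  by (simp add: \<rho>_def)

lemma r_measurable [measurable]: "r \<in> borel_measurable M"
  unfolding r_def[abs_def] by measurable

lemma density_rho: "density M \<rho> = distr M M \<phi>"
  unfolding \<rho>_def using equivalent by (intro density_RN_deriv) (auto simp: equivalent_measures_def)

text \<open>A null set has null preimage because the image measure is absolutely continuous with
  respect to \<open>M\<close>. This is how statements at \<open>x\<close> are moved to
  \<open>x + \<delta> k\<close> and to \<open>check x\<close>.\<close>

lemma AE_inv:
  assumes "AE x in M. P x"
  shows "AE x in M. P (\<phi> x)"
proof -
  obtain N where N: "{x \<in> space M. \<not> P x} \<subseteq> N" "N \<in> null_sets M"
    using assms unfolding eventually_ae_filter by auto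
  then have "N \<in> null_sets (distr M M \<phi>)"
    using equivalent by (auto simp: equivalent_measures_def absolutely_continuous_def)
  then have "\<phi> -` N \<inter> space M \<in> null_sets M"
    using N(2) by (auto simp: null_sets_def emeasure_distr)
  moreover have "{x \<in> space M. \<not> P (\<phi> x)} \<subseteq> \<phi> -` N \<inter> space M"
    using N(1) measurable_space[OF measurable_inv] by auto
  ultimately show ?thesis
    by (rule AE_I')
qed

text \<open>Borel measurability of the map is not enough for the completion: the preimage of a null
  set must again be null, and this is where nonsingularity enters.\<close>

lemma measurable_inv_completion: "\<phi> \<in> measurable (completion M) (completion M)"
proof (rule measurableI)
  show "\<phi> x \<in> space (completion M)" if "x \<in> space (completion M)" for x
    using that measurable_space[OF measurable_inv] by simp
  fix A assume "A \<in> sets (completion M)"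
  then obtain S N N' where A: "A = S \<union> N" "N \<subseteq> N'" "N' \<in> null_sets M" "S \<in> sets M"
    by (rule sets_completionE)
  have "\<phi> -` N' \<inter> space M \<in> null_sets M"
  proof (rule AE_iff_null_sets[THEN iffD2])
    show "AE x in M. x \<notin> \<phi> -` N' \<inter> space M"
      using AE_inv[OF AE_not_in[OF A(3)]] by eventually_elim simp
  qed (use measurable_sets[OF measurable_inv] A(3) in blast)
  then show "\<phi> -` A \<inter> space (completion M) \<in> sets (completion M)"
    using A measurable_sets[OF measurable_inv A(4)]
    by (intro sets_completionI[of _ "\<phi> -` S \<inter> space M" "\<phi> -` N \<inter> space M" "\<phi> -` N' \<inter> space M"]) auto
qed

lemma measurable_compose_inv:
  "f \<in> measurable (completion M) N \<Longrightarrow> (\<lambda>x. f (\<phi> x)) \<in> measurable (completion M) N"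
  using measurable_compose[OF measurable_inv_completion] .

text \<open>Change of variables for a map that is its own inverse. A Borel version of
  \<open>F\<close> is used because the formulas for densities and image measures concern
  \<open>M\<close>, not its completion.\<close>

lemma nn_integral_inv:
  assumes F: "F \<in> borel_measurable (completion M)"
  shows "(\<integral>\<^sup>+x. \<rho> x * F (\<phi> x) \<partial>M) = (\<integral>\<^sup>+x. F x \<partial>M)"
proof -
  obtain G where [measurable]: "G \<in> borel_measurable M" and FG: "AE x in M. F x = G x"
    using completion_ex_borel_measurable[OF F] by auto
  have "(\<integral>\<^sup>+x. \<rho> x * F (\<phi> x) \<partial>M) = (\<integral>\<^sup>+x. \<rho> x * G (\<phi> x) \<partial>M)"
    using AE_inv[OF FG] by (intro nn_integral_cong_AE) auto
  also have "\<dots> = (\<integral>\<^sup>+x. G (\<phi> x) \<partial>density M \<rho>)"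
    by (rule nn_integral_density[symmetric]) measurable
  also have "\<dots> = (\<integral>\<^sup>+x. G (\<phi> (\<phi> x)) \<partial>M)"
    unfolding density_rho by (rule nn_integral_distr) measurable
  also have "\<dots> = (\<integral>\<^sup>+x. F x \<partial>M)"
    using FG by (intro nn_integral_cong_AE) auto
  finally show ?thesis .
qed

lemma nn_integral_inv_borel:
  "F \<in> borel_measurable M \<Longrightarrow> (\<integral>\<^sup>+x. \<rho> x * F (\<phi> x) \<partial>M) = (\<integral>\<^sup>+x. F x \<partial>M)"
  by (rule nn_integral_inv) (rule measurable_completion)

text \<open>Two changes of variables along an involution restore the original integral, so the
  product is a density of \<open>M\<close> with respect to itself; sigma-finiteness makes densities
  unique.\<close>

lemma rho_cancel: "AE x in M. \<rho> x * \<rho> (\<phi> x) = 1"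
proof (rule density_unique)
  show "density M (\<lambda>x. \<rho> x * \<rho> (\<phi> x)) = density M (\<lambda>_. 1)"
  proof (rule measure_eqI)
    fix A assume "A \<in> sets (density M (\<lambda>x. \<rho> x * \<rho> (\<phi> x)))"
    then have [measurable]: "A \<in> sets M"
      by simp
    have "(\<integral>\<^sup>+x. \<rho> x * \<rho> (\<phi> x) * indicator A x \<partial>M)
        = (\<integral>\<^sup>+x. \<rho> x * (\<lambda>y. \<rho> y * indicator A (\<phi> y)) (\<phi> x) \<partial>M)"
      by (simp add: mult.assoc)
    also have "\<dots> = (\<integral>\<^sup>+x. \<rho> x * indicator A (\<phi> x) \<partial>M)"
      by (rule nn_integral_inv_borel) measurable
    also have "\<dots> = (\<integral>\<^sup>+x. indicator A x \<partial>M)"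
      by (rule nn_integral_inv_borel) measurable
    finally show "emeasure (density M (\<lambda>x. \<rho> x * \<rho> (\<phi> x))) A = emeasure (density M (\<lambda>_. 1)) A"
      by (simp add: emeasure_density)
  qed simp
qed measurable

lemma r_facts: "AE x in M. 0 < r x \<and> ennreal ((r x)\<^sup>2) = \<rho> x \<and> r x * r (\<phi> x) = 1"
  using rho_cancel
proof eventually_elim
  fix x assume *: "\<rho> x * \<rho> (\<phi> x) = 1"
  \<comment> \<open>A product equal to 1 excludes the value infinity for either factor, even against
    a factor 0.\<close>
  have fin: "\<rho> x < top \<and> \<rho> (\<phi> x) < top"
    using * by (metis ennreal_mult_eq_top_iff ennreal_one_neq_top less_top mult_zero_left
        mult_zero_right zero_neq_one)
  then obtain a b where ab: "\<rho> x = ennreal a" "\<rho> (\<phi> x) = ennreal b" "0 \<le> a" "0 \<le> b"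
    by (metis ennreal_cases less_top_ennreal order_less_irrefl)
  then have "ennreal (a * b) = ennreal 1"
    using * by (simp add: ennreal_mult)
  then have "a * b = 1"
    using ab(3,4) by (subst (asm) ennreal_inj) auto
  then have "0 < a" "sqrt a * sqrt b = 1"
    using ab(3,4) by (auto simp: real_sqrt_mult[symmetric] less_le)
  then show "0 < r x \<and> ennreal ((r x)\<^sup>2) = \<rho> x \<and> r x * r (\<phi> x) = 1"
    using ab by (simp add: r_def)
qed

lemma r_pos: "AE x in M. 0 < r x"
  using r_facts by eventually_elim simp

lemma r_cancel: "AE x in M. r x * r (\<phi> x) = 1"
  using r_facts by eventually_elim simp

end

text \<open>Both products are densities of the image of \<open>M\<close> under the composite of the
  two commuting maps. In square-root form this makes the weights of the flip and of a translation
  compatible.\<close>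

lemma rho_cocycle:
  assumes "nonsingular_involution M \<phi>" "nonsingular_involution M \<psi>"
    and comm: "\<And>x. \<phi> (\<psi> x) = \<psi> (\<phi> x)"
  shows "AE x in M. nonsingular_involution.\<rho> M \<phi> x * nonsingular_involution.\<rho> M \<psi> (\<phi> x)
    = nonsingular_involution.\<rho> M \<psi> x * nonsingular_involution.\<rho> M \<phi> (\<psi> x)"
proof -
  interpret p: nonsingular_involution M \<phi> by fact
  interpret s: nonsingular_involution M \<psi> by fact
  show ?thesis
  proof (rule p.density_unique)
    show "density M (\<lambda>x. p.\<rho> x * s.\<rho> (\<phi> x)) = density M (\<lambda>x. s.\<rho> x * p.\<rho> (\<psi> x))"
    proof (rule measure_eqI)
      fix A assume "A \<in> sets (density M (\<lambda>x. p.\<rho> x * s.\<rho> (\<phi> x)))"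
      then have [measurable]: "A \<in> sets M"
        by simp
      have "(\<integral>\<^sup>+x. p.\<rho> x * s.\<rho> (\<phi> x) * indicator A x \<partial>M)
          = (\<integral>\<^sup>+x. p.\<rho> x * (\<lambda>y. s.\<rho> y * indicator A (\<phi> y)) (\<phi> x) \<partial>M)"
        by (simp add: mult.assoc)
      also have "\<dots> = (\<integral>\<^sup>+x. s.\<rho> x * (\<lambda>y. indicator A (\<phi> (\<psi> y))) (\<psi> x) \<partial>M)"
        by (subst p.nn_integral_inv_borel) (simp_all, measurable)
      also have "\<dots> = (\<integral>\<^sup>+x. indicator A (\<phi> (\<psi> x)) \<partial>M)"
        by (subst s.nn_integral_inv_borel) (simp_all, measurable)
      finally have 1: "(\<integral>\<^sup>+x. p.\<rho> x * s.\<rho> (\<phi> x) * indicator A x \<partial>M)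
          = (\<integral>\<^sup>+x. indicator A (\<phi> (\<psi> x)) \<partial>M)" .
      have "(\<integral>\<^sup>+x. s.\<rho> x * p.\<rho> (\<psi> x) * indicator A x \<partial>M)
          = (\<integral>\<^sup>+x. s.\<rho> x * (\<lambda>y. p.\<rho> y * indicator A (\<psi> y)) (\<psi> x) \<partial>M)"
        by (simp add: mult.assoc)
      also have "\<dots> = (\<integral>\<^sup>+x. p.\<rho> x * (\<lambda>y. indicator A (\<psi> (\<phi> y))) (\<phi> x) \<partial>M)"
        by (subst s.nn_integral_inv_borel) (simp_all, measurable)
      also have "\<dots> = (\<integral>\<^sup>+x. indicator A (\<psi> (\<phi> x)) \<partial>M)"
        by (subst p.nn_integral_inv_borel) (simp_all, measurable)
      finally show "emeasure (density M (\<lambda>x. p.\<rho> x * s.\<rho> (\<phi> x))) A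
          = emeasure (density M (\<lambda>x. s.\<rho> x * p.\<rho> (\<psi> x))) A"
        using 1 by (simp add: emeasure_density comm)
    qed simp
  qed measurable
qed

lemma r_cocycle:
  assumes "nonsingular_involution M \<phi>" "nonsingular_involution M \<psi>"
    and comm: "\<And>x. \<phi> (\<psi> x) = \<psi> (\<phi> x)"
  shows "AE x in M. nonsingular_involution.r M \<phi> x * nonsingular_involution.r M \<psi> (\<phi> x)
    = nonsingular_involution.r M \<psi> x * nonsingular_involution.r M \<phi> (\<psi> x)"
proof -
  interpret p: nonsingular_involution M \<phi> by fact
  interpret s: nonsingular_involution M \<psi> by fact
  show ?thesis
    using rho_cocycle[OF assms]
    by eventually_elim (simp add: p.r_def s.r_def real_sqrt_mult[symmetric] enn2real_mult[symmetric])
qed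

section \<open>The group of 0-1 sequences\<close>

lemma bit_add_self [simp]: "b + b = (0 :: bit)"
  by (cases b) auto

lemma add_delta_involutive [simp]: "x + \<delta> k + \<delta> k = x"
  by (simp add: fun_eq_iff add.assoc)

lemma check_involutive [simp]: "check (check x) = x"
  by (simp add: check_def fun_eq_iff add.assoc)

lemma check_add_delta: "check (x + \<delta> k) = check x + \<delta> k"
  by (simp add: check_def fun_eq_iff add_ac)

lemma delta_in_Delta: "\<delta> k \<in> \<Delta>"
  by (simp add: \<Delta>_def \<delta>_def)

lemma check_eq_1_iff: "check x k = 1 \<longleftrightarrow> x k \<noteq> 1"
  by (cases "x k") (auto simp: check_def)

lemma add_delta_eq_1_iff: "(x + \<delta> k) j = 1 \<longleftrightarrow> (if j = k then x k \<noteq> 1 else x j = 1)"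
  by (cases "x k") (auto simp: \<delta>_def)

lemma borel_measurable_add_cantor: "(\<lambda>x :: cantor. x + d) \<in> borel_measurable borel"
proof (rule borel_measurable_continuous_onI, rule continuous_on_coordinatewise_then_product)
  fix i
  have bit: "continuous_on UNIV (\<lambda>b. b + d i)"
    by (auto simp: continuous_on_open_vimage open_bit_def)
  show "continuous_on UNIV (\<lambda>x :: cantor. (x + d) i)"
    using continuous_on_compose2[OF bit continuous_on_product_coordinates[of i]] by simp
qed

lemma sets_coordinate: "{x :: cantor. x k \<in> B} \<in> sets borel"
proof -
  have "open B"
    by (simp add: open_bit_def)
  then have "open ((\<lambda>x :: cantor. x k) -` B)"
    by (intro open_vimage continuous_on_product_coordinates) auto
  then show ?thesis
    by (simp add: vimage_def)
qed

section \<open>Signs attached to the coordinates\<close>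

definition coord_sign :: "nat \<Rightarrow> cantor \<Rightarrow> complex"
  where "coord_sign k x = (if x k = 1 then -1 else 1)"

lemma parity_sign_0: "parity_sign 0 x = 1"
  by (simp add: parity_sign_def)

lemma parity_sign_Suc: "parity_sign (Suc k) x = parity_sign k x * coord_sign k x"
  by (simp add: parity_sign_def coord_sign_def lessThan_Suc power_add)

lemma coord_sign_check: "coord_sign k (check x) = - coord_sign k x"
  by (simp add: coord_sign_def check_eq_1_iff)

lemma coord_sign_add_delta: "coord_sign k (x + \<delta> j) = (if j = k then - coord_sign k x else coord_sign k x)"
  unfolding coord_sign_def add_delta_eq_1_iff by auto

lemma parity_sign_check: "parity_sign k (check x) = (-1) ^ k * parity_sign k x"
  by (induction k) (simp_all add: parity_sign_0 parity_sign_Suc coord_sign_check)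

lemma parity_sign_add_delta: "k \<le> j \<Longrightarrow> parity_sign k (x + \<delta> j) = parity_sign k x"
  by (induction k) (simp_all add: parity_sign_0 parity_sign_Suc coord_sign_add_delta)

lemma cmod_coord_sign [simp]: "cmod (coord_sign k x) = 1"
  by (simp add: coord_sign_def)

lemma cmod_parity_sign [simp]: "cmod (parity_sign k x) = 1"
  by (induction k) (simp_all add: parity_sign_0 parity_sign_Suc norm_mult)

lemma cnj_parity_sign [simp]: "cnj (parity_sign k x) = parity_sign k x"
  by (induction k) (simp_all add: parity_sign_0 parity_sign_Suc coord_sign_def)

lemma parity_sign_square: "parity_sign k x * parity_sign k x = 1"
  using complex_norm_square[of "parity_sign k x"] by simp

section \<open>The direct integral\<close>

text \<open>The squared norm as an extended integral over \<mu> itself: finiteness expresses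
  square-integrability, and no integrability conditions accompany the computations.\<close>

definition sqnorm_integral :: "cantor measure \<Rightarrow> (cantor \<Rightarrow> vec) \<Rightarrow> ennreal"
  where "sqnorm_integral \<mu> f = (\<integral>\<^sup>+x. ennreal ((hnorm (f x))\<^sup>2) \<partial>\<mu>)"

context garding_wightman_triple
begin

abbreviation "V \<equiv> direct_integral \<mu> \<nu>"

lemma space_mu [simp]: "space \<mu> = UNIV"
  using sets_eq_imp_space_eq[OF sets_mu] by simp

lemma measurable_mu_mu: "f \<in> measurable borel borel \<Longrightarrow> f \<in> measurable \<mu> \<mu>"
  using measurable_cong_sets[OF sets_mu sets_mu] by blast

lemma measurable_fieldD:
  assumes "measurable_field \<mu> \<nu> f"
  shows "(\<lambda>x. f x i) \<in> borel_measurable (completion \<mu>)" "AE x in \<mu>. f x \<in> hilb (\<nu> x)"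
  using assms by (auto simp: measurable_field_def)

lemma hnorm_measurable:
  assumes "measurable_field \<mu> \<nu> f"
  shows "(\<lambda>x. hnorm (f x)) \<in> borel_measurable (completion \<mu>)"
proof -
  note [measurable] = measurable_fieldD(1)[OF assms]
  show ?thesis
    unfolding hnorm_def by measurable
qed

lemma direct_integral_iff:
  "f \<in> V \<longleftrightarrow> measurable_field \<mu> \<nu> f \<and> sqnorm_integral \<mu> f < \<infinity>"
  using hnorm_measurable[of f]
  by (auto simp: direct_integral_def integrable_iff_bounded nn_integral_completion sqnorm_integral_def)

lemma l2norm_eq: "f \<in> V \<Longrightarrow> l2norm \<mu> f = sqrt (enn2real (sqnorm_integral \<mu> f))"
  using hnorm_measurable[of f] unfolding direct_integral_iff
  by (simp add: l2norm_def sqnorm_integral_def integral_eq_nn_integral nn_integral_completion)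

lemma l2norm_eq_iff:
  assumes "f \<in> V" "g \<in> V"
  shows "l2norm \<mu> f = l2norm \<mu> g \<longleftrightarrow> sqnorm_integral \<mu> f = sqnorm_integral \<mu> g"
  using assms unfolding l2norm_eq[OF assms(1)] l2norm_eq[OF assms(2)] direct_integral_iff
  by (metis ennreal_enn2real infinity_ennreal_def real_sqrt_eq_iff)

lemma measurable_field_scale:
  assumes "\<kappa> \<in> borel_measurable (completion \<mu>)" "measurable_field \<mu> \<nu> f"
  shows "measurable_field \<mu> \<nu> (\<lambda>x. hscale (\<kappa> x) (f x))"
  unfolding measurable_field_def
proof (intro conjI allI)
  show "(\<lambda>x. hscale (\<kappa> x) (f x) i) \<in> borel_measurable (completion \<mu>)" for i
    unfolding hscale_def by (intro borel_measurable_times assms(1) measurable_fieldD(1)[OF assms(2)])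
  show "AE x in \<mu>. hscale (\<kappa> x) (f x) \<in> hilb (\<nu> x)"
    using measurable_fieldD(2)[OF assms(2)] by eventually_elim (rule hilb_hscale)
qed

lemma direct_integral_scale:
  assumes \<kappa>: "\<kappa> \<in> borel_measurable (completion \<mu>)" "\<And>x. cmod (\<kappa> x) \<le> C" and f: "f \<in> V"
  shows "(\<lambda>x. hscale (\<kappa> x) (f x)) \<in> V"
proof -
  have m: "measurable_field \<mu> \<nu> f"
    using f by (simp add: direct_integral_iff)
  have "sqnorm_integral \<mu> (\<lambda>x. hscale (\<kappa> x) (f x))
      \<le> (\<integral>\<^sup>+x. ennreal (C\<^sup>2) * ennreal ((hnorm (f x))\<^sup>2) \<partial>\<mu>)"
    unfolding sqnorm_integral_def
  proof (rule nn_integral_mono_AE)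
    show "AE x in \<mu>. ennreal ((hnorm (hscale (\<kappa> x) (f x)))\<^sup>2) \<le> ennreal (C\<^sup>2) * ennreal ((hnorm (f x))\<^sup>2)"
      using measurable_fieldD(2)[OF m]
    proof eventually_elim
      case (elim x)
      have "(cmod (\<kappa> x))\<^sup>2 \<le> C\<^sup>2"
        by (rule power_mono[OF \<kappa>(2)]) simp
      then show ?case
        using elim by (simp add: ennreal_mult'[symmetric] power_mult_distrib mult_right_mono)
    qed
  qed
  also have "\<dots> = ennreal (C\<^sup>2) * sqnorm_integral \<mu> f"
    unfolding sqnorm_integral_def nn_integral_completion[of \<mu>, symmetric]
    using hnorm_measurable[OF m] by (intro nn_integral_cmult) measurable
  also have "\<dots> < \<infinity>"
    using f by (auto simp: direct_integral_iff ennreal_mult_less_top)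
  finally show ?thesis
    using measurable_field_scale[OF \<kappa>(1) m] by (simp add: direct_integral_iff)
qed

lemma direct_integral_const_scale: "f \<in> V \<Longrightarrow> (\<lambda>x. hscale a (f x)) \<in> V"
  by (rule direct_integral_scale[of _ "cmod a"]) auto

lemma direct_integral_add:
  assumes f: "f \<in> V" and g: "g \<in> V"
  shows "f + g \<in> V"
proof -
  have m: "measurable_field \<mu> \<nu> f" "measurable_field \<mu> \<nu> g"
    using f g by (simp_all add: direct_integral_iff)
  have "AE x in \<mu>. (f + g) x \<in> hilb (\<nu> x)"
    using measurable_fieldD(2)[OF m(1)] measurable_fieldD(2)[OF m(2)]
    by eventually_elim (simp only: plus_fun_apply hilb_add)
  moreover have "(\<lambda>x. (f + g) x i) \<in> borel_measurable (completion \<mu>)" for i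
    using measurable_fieldD(1)[OF m(1), of i] measurable_fieldD(1)[OF m(2), of i] by simp
  ultimately have fg: "measurable_field \<mu> \<nu> (f + g)"
    by (simp only: measurable_field_def simp_thms)
  have "sqnorm_integral \<mu> (f + g)
      \<le> (\<integral>\<^sup>+x. 2 * ennreal ((hnorm (f x))\<^sup>2) + 2 * ennreal ((hnorm (g x))\<^sup>2) \<partial>\<mu>)"
    unfolding sqnorm_integral_def
  proof (rule nn_integral_mono_AE)
    show "AE x in \<mu>. ennreal ((hnorm ((f + g) x))\<^sup>2)
        \<le> 2 * ennreal ((hnorm (f x))\<^sup>2) + 2 * ennreal ((hnorm (g x))\<^sup>2)"
      using measurable_fieldD(2)[OF m(1)] measurable_fieldD(2)[OF m(2)]
    proof eventually_elim
      case (elim x)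
      have "(hnorm (f x + g x))\<^sup>2 \<le> (hnorm (f x) + hnorm (g x))\<^sup>2"
        using elim by (intro power_mono hnorm_triangle[of _ "\<nu> x"] hnorm_nonneg[of _ "\<nu> x"] hilb_add)
      also have "\<dots> \<le> 2 * (hnorm (f x))\<^sup>2 + 2 * (hnorm (g x))\<^sup>2"
        using sum_squares_bound[of "hnorm (f x)" "hnorm (g x)"] by (simp add: power2_sum)
      finally have "ennreal ((hnorm (f x + g x))\<^sup>2)
          \<le> ennreal (2 * (hnorm (f x))\<^sup>2 + 2 * (hnorm (g x))\<^sup>2)"
        by (rule ennreal_leI)
      then show ?case
        by (simp add: ennreal_plus ennreal_mult')
    qed
  qed
  also have "\<dots> = 2 * sqnorm_integral \<mu> f + 2 * sqnorm_integral \<mu> g"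
    unfolding sqnorm_integral_def nn_integral_completion[of \<mu>, symmetric]
    using hnorm_measurable[OF m(1)] hnorm_measurable[OF m(2)]
    by (simp add: nn_integral_add nn_integral_cmult)
  also have "\<dots> < \<infinity>"
    using f g by (auto simp: direct_integral_iff ennreal_mult_less_top)
  finally show ?thesis
    using fg by (simp add: direct_integral_iff)
qed

lemma sqnorm_integral_cong_AE:
  "(AE x in \<mu>. hnorm (f x) = hnorm (g x)) \<Longrightarrow> sqnorm_integral \<mu> f = sqnorm_integral \<mu> g"
  unfolding sqnorm_integral_def by (intro nn_integral_cong_AE) auto

section \<open>Weighted composition along a nonsingular involution\<close>

lemma measurable_field_compose:
  assumes "nonsingular_involution \<mu> \<phi>" "AE x in \<mu>. \<nu> (\<phi> x) = \<nu> x" "measurable_field \<mu> \<nu> f"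
  shows "measurable_field \<mu> \<nu> (\<lambda>x. f (\<phi> x))"
proof -
  interpret nonsingular_involution \<mu> \<phi> by fact
  have "AE x in \<mu>. f (\<phi> x) \<in> hilb (\<nu> x)"
    using AE_inv[OF measurable_fieldD(2)[OF assms(3)]] assms(2) by eventually_elim simp
  then show ?thesis
    using measurable_compose_inv[OF measurable_fieldD(1)[OF assms(3)]]
    by (simp add: measurable_field_def)
qed

text \<open>Since the square of \<open>r\<close> is the density \<rho>, the change of variables
  absorbs the weight and the norm is preserved. The scalar map \<sigma> is left open so that this
  serves both the linear Clifford operators and the antilinear \<open>T\<close>.\<close>

lemma weighted_composition:
  assumes inv: "nonsingular_involution \<mu> \<phi>" and \<nu>: "AE x in \<mu>. \<nu> (\<phi> x) = \<nu> x"
    and T: "measurable_operator_field \<mu> \<nu> T"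
      "AE x in \<mu>. semilinear_isometry \<sigma> (hilb (\<nu> x)) (hilb (\<nu> x)) (T x)"
    and \<kappa>: "\<kappa> \<in> borel_measurable \<mu>" "\<And>x. cmod (\<kappa> x) = 1"
    and f: "f \<in> V"
  defines "W \<equiv> (\<lambda>x. hscale (\<kappa> x * complex_of_real (nonsingular_involution.r \<mu> \<phi> x)) (T x (f (\<phi> x))))"
  shows "W \<in> V" "sqnorm_integral \<mu> W = sqnorm_integral \<mu> f"
proof -
  interpret nonsingular_involution \<mu> \<phi> by fact
  have m: "measurable_field \<mu> \<nu> f"
    using f by (simp add: direct_integral_iff)
  have mc: "measurable_field \<mu> \<nu> (\<lambda>x. f (\<phi> x))"
    by (rule measurable_field_compose[OF inv \<nu> m])
  have "AE x in \<mu>. T x (f (\<phi> x)) \<in> hilb (\<nu> x)"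
    using T(2) measurable_fieldD(2)[OF mc] by eventually_elim (rule semilinear_isometryD(1))
  then have mT: "measurable_field \<mu> \<nu> (\<lambda>x. T x (f (\<phi> x)))"
    using T(1) mc by (auto simp: measurable_field_def measurable_operator_field_def)
  have "(\<lambda>x. \<kappa> x * complex_of_real (r x)) \<in> borel_measurable (completion \<mu>)"
    by (intro measurable_completion borel_measurable_times \<kappa>(1) measurable_compose[OF r_measurable borel_measurable_of_real])
  then have mW: "measurable_field \<mu> \<nu> W"
    unfolding W_def by (rule measurable_field_scale[OF _ mT])
  have "sqnorm_integral \<mu> W = (\<integral>\<^sup>+x. \<rho> x * ennreal ((hnorm (f (\<phi> x)))\<^sup>2) \<partial>\<mu>)"
    unfolding sqnorm_integral_def
  proof (rule nn_integral_cong_AE)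
    show "AE x in \<mu>. ennreal ((hnorm (W x))\<^sup>2) = \<rho> x * ennreal ((hnorm (f (\<phi> x)))\<^sup>2)"
      using T(2) measurable_fieldD(2)[OF mc] measurable_fieldD(2)[OF mT] r_facts
    proof eventually_elim
      case (elim x)
      have "(hnorm (W x))\<^sup>2 = (r x)\<^sup>2 * (hnorm (f (\<phi> x)))\<^sup>2"
        using elim(4) unfolding W_def hnorm_hscale[OF elim(3)] semilinear_isometryD(4)[OF elim(1,2)]
        by (simp add: norm_mult \<kappa>(2) power_mult_distrib)
      then show ?case
        using elim(4) by (simp add: ennreal_mult')
    qed
  qed
  also have "\<dots> = sqnorm_integral \<mu> f"
    unfolding sqnorm_integral_def using hnorm_measurable[OF m] by (intro nn_integral_inv) measurable
  finally show "sqnorm_integral \<mu> W = sqnorm_integral \<mu> f" .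
  then show "W \<in> V"
    using mW f by (simp add: direct_integral_iff)
qed

section \<open>The Clifford operators as weighted translations\<close>

lemma translation_involution: "nonsingular_involution \<mu> (\<lambda>x. x + \<delta> k)"
proof
  show "(\<lambda>x. x + \<delta> k) \<in> measurable \<mu> \<mu>"
    by (rule measurable_mu_mu[OF borel_measurable_add_cantor])
  show "equivalent_measures (distr \<mu> \<mu> (\<lambda>x. x + \<delta> k)) \<mu>"
    using quasi_invariant[OF delta_in_Delta] by (simp add: translate_measure_def)
qed simp

sublocale shift: nonsingular_involution \<mu> "\<lambda>x. x + \<delta> k" for k
  by (rule translation_involution)

lemma sqrt_density_eq: "sqrt_density \<mu> k = shift.r k"
  by (simp add: fun_eq_iff sqrt_density_def shift.r_def shift.\<rho>_def translate_measure_def)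

lemma nu_shift: "AE x in \<mu>. \<nu> (x + \<delta> k) = \<nu> x"
  by (rule nu_invariant[OF delta_in_Delta])

lemma c_isometry: "AE x in \<mu>. semilinear_isometry id (hilb (\<nu> x)) (hilb (\<nu> x)) (c k x)"
  using c_unitary[of k] nu_shift[of k] by eventually_elim (metis unitary_isometry)

lemma c_right_inverse: "AE x in \<mu>. \<forall>v\<in>hilb (\<nu> x). c k x (c k (x + \<delta> k) v) = v"
  using c_unitary[of k] c_adjoint[of k] nu_shift[of k]
  by eventually_elim (metis unitary_adjoint_right_inverse)

text \<open>The operators \<open>J\<close> and \<open>J'\<close> differ only in a factor of modulus
  1, here \<kappa>, so both are handled together.\<close>

definition clifford :: "(cantor \<Rightarrow> complex) \<Rightarrow> nat \<Rightarrow> (cantor \<Rightarrow> vec) \<Rightarrow> cantor \<Rightarrow> vec"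
  where "clifford \<kappa> k f = (\<lambda>x. hscale (\<kappa> x * complex_of_real (shift.r k x)) (c k x (f (x + \<delta> k))))"

definition J_phase :: "nat \<Rightarrow> cantor \<Rightarrow> complex"
  where "J_phase k x = - \<i> * parity_sign k x"

lemma J_eq: "J \<mu> c k = clifford (J_phase k) k"
  by (simp add: fun_eq_iff J_def clifford_def J_phase_def sqrt_density_eq)

lemma J'_eq: "J' \<mu> c k = clifford (parity_sign (Suc k)) k"
  by (simp add: fun_eq_iff J'_def clifford_def sqrt_density_eq)

lemma coord_sign_measurable [measurable]: "coord_sign k \<in> borel_measurable \<mu>"
proof -
  have "{x \<in> space \<mu>. x k = 1} \<in> sets \<mu>"
    using sets_coordinate[of k "{1}"] by (simp add: sets_mu)
  then show ?thesis
    unfolding coord_sign_def[abs_def] by (intro measurable_If) auto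
qed

lemma parity_sign_measurable [measurable]: "parity_sign k \<in> borel_measurable \<mu>"
  by (induction k) (simp_all add: parity_sign_0[abs_def] parity_sign_Suc[abs_def])

lemma J_phase_measurable [measurable]: "J_phase k \<in> borel_measurable \<mu>"
  unfolding J_phase_def[abs_def] by measurable

lemma cmod_J_phase [simp]: "cmod (J_phase k x) = 1"
  by (simp add: J_phase_def norm_mult)

text \<open>These conjugation rules are what force the sign in \<open>q(x) c\<^sub>k(check x) = \<plusminus> c\<^sub>k(x) q(x + \<delta>\<^sup>k)\<close>.\<close>

lemma cnj_J_phase_check: "cnj (J_phase k (check x)) = (-1) ^ Suc k * J_phase k x"
  by (simp add: J_phase_def parity_sign_check)

lemma cnj_parity_sign_check: "cnj (parity_sign (Suc k) (check x)) = (-1) ^ Suc k * parity_sign (Suc k) x"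
  by (simp only: parity_sign_check cnj_parity_sign complex_cnj_mult complex_cnj_power complex_cnj_minus complex_cnj_one)

lemma clifford_in_V:
  assumes "\<kappa> \<in> borel_measurable \<mu>" "\<And>x. cmod (\<kappa> x) = 1" "f \<in> V"
  shows "clifford \<kappa> k f \<in> V"
  unfolding clifford_def
  by (rule weighted_composition(1)[OF translation_involution nu_shift c_measurable c_isometry assms])

lemma clifford_cong: "ae_eq \<mu> f g \<Longrightarrow> ae_eq \<mu> (clifford \<kappa> k f) (clifford \<kappa> k g)"
  unfolding ae_eq_def clifford_def
  using shift.AE_inv[of "\<lambda>x. f x = g x" k] by (auto elim: eventually_mono)

text \<open>Translating twice by \<open>\<delta> k\<close> is the identity, the two unitaries are
  adjoint to each other and the two weights multiply to 1. What is left is multiplication by a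
  scalar function.\<close>

lemma clifford_clifford:
  assumes "f \<in> V"
  shows "AE x in \<mu>. clifford \<kappa> k (clifford \<eta> k f) x = hscale (\<kappa> x * \<eta> (x + \<delta> k)) (f x)"
proof -
  have m: "AE x in \<mu>. f x \<in> hilb (\<nu> x)"
    using assms measurable_fieldD(2) by (simp add: direct_integral_iff)
  show ?thesis
    using m c_isometry[of k] shift.AE_inv[OF c_isometry[of k], of k] nu_shift[of k] c_right_inverse[of k]
      shift.r_cancel[of k]
  proof eventually_elim
    case (elim x)
    let ?y = "x + \<delta> k"
    have cy: "c k ?y (f x) \<in> hilb (\<nu> x)"
      using semilinear_isometryD(1)[OF elim(2)] semilinear_isometryD(1)[OF elim(3)] elim(1,4) by metis
    have "clifford \<kappa> k (clifford \<eta> k f) x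
        = hscale (\<kappa> x * shift.r k x) (c k x (hscale (\<eta> ?y * shift.r k ?y) (c k ?y (f x))))"
      by (simp add: clifford_def)
    also have "c k x (hscale (\<eta> ?y * shift.r k ?y) (c k ?y (f x)))
        = hscale (\<eta> ?y * shift.r k ?y) (f x)"
      using semilinear_isometryD(3)[OF elim(2) cy] elim(5,1) by simp
    also have "hscale (\<kappa> x * shift.r k x) (hscale (\<eta> ?y * shift.r k ?y) (f x))
        = hscale (\<kappa> x * \<eta> ?y * complex_of_real (shift.r k x * shift.r k ?y)) (f x)"
      by (simp add: mult_ac)
    also have "\<dots> = hscale (\<kappa> x * \<eta> ?y) (f x)"
      by (simp only: elim(6) of_real_1 mult_1_right)
    finally show ?case .
  qed
qed

text \<open>Translation by \<open>\<delta> k\<close> keeps the parity of the earlier coordinates and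
  reverses the sign of coordinate \<open>k\<close>; this reversal cancels the minus sign in front of
  \<i>.\<close>

lemma J_J':
  assumes "f \<in> V"
  shows "AE x in \<mu>. J \<mu> c k (J' \<mu> c k f) x = hscale (\<i> * coord_sign k x) (f x)"
proof -
  have "J_phase k x * parity_sign (Suc k) (x + \<delta> k) = \<i> * coord_sign k x" for x
    using parity_sign_square[of k x]
    by (simp add: J_phase_def parity_sign_Suc coord_sign_add_delta parity_sign_add_delta mult.assoc[symmetric])
  then show ?thesis
    unfolding J_eq J'_eq using clifford_clifford[OF assms, of "J_phase k" k "parity_sign (Suc k)"] by simp
qed

end

section \<open>The operator induced by a field of antilinear isometries\<close>

lemma equivalent_measures_sym: "equivalent_measures M N \<Longrightarrow> equivalent_measures N M"
  by (auto simp: equivalent_measures_def)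

lemma minus_one_power_square: "(-1) ^ n * (-1) ^ n = (1 :: complex)"
  by (simp add: power_mult_distrib[symmetric])

lemma hnorm_std_basis: "hnorm (std_basis n i) = (if enat i < n then 1 else 0)"
proof -
  have "of_real ((hnorm (std_basis n i))\<^sup>2) = (of_real (if enat i < n then 1 else 0) :: complex)"
    unfolding hinner_self[OF std_basis_hilb, symmetric] hinner_std_basis by (simp add: std_basis_def)
  then have "(hnorm (std_basis n i))\<^sup>2 = (if enat i < n then 1 else 0)"
    by (simp only: of_real_eq_iff)
  then show ?thesis
    using hnorm_nonneg[OF std_basis_hilb, of n i] by (auto simp: power2_eq_1_iff split: if_splits)
qed

section \<open>A countable family of fields that is total in every fibre\<close>

context garding_wightman_triple
begin

text \<open>The weight makes the constant fields square-integrable although \<open>\<mu>\<close> need not be finite.\<close>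

definition weight :: "cantor \<Rightarrow> real"
  where "weight = (SOME w. w \<in> borel_measurable \<mu> \<and> (\<forall>x. 0 < w x) \<and> (\<forall>x. w x \<le> 1) \<and> integrable \<mu> w)"

lemma weight:
  "weight \<in> borel_measurable \<mu>" "0 < weight x" "weight x \<le> 1" "integrable \<mu> weight"
proof -
  have "\<exists>w. w \<in> borel_measurable \<mu> \<and> (\<forall>x. 0 < w x) \<and> (\<forall>x. w x \<le> 1) \<and> integrable \<mu> (w :: _ \<Rightarrow> real)"
    using obtain_positive_integrable_function by metis
  from someI_ex[OF this] show "weight \<in> borel_measurable \<mu>" "0 < weight x" "weight x \<le> 1"
    "integrable \<mu> weight"
    unfolding weight_def by auto
qed

definition basis_field :: "nat \<Rightarrow> cantor \<Rightarrow> vec"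
  where "basis_field i x = hscale (complex_of_real (weight x)) (std_basis (\<nu> x) i)"

lemma hnorm_basis_field: "hnorm (basis_field i x) = (if enat i < \<nu> x then weight x else 0)"
  using weight(2)[of x] by (simp add: basis_field_def hnorm_hscale[OF std_basis_hilb] hnorm_std_basis)

lemma basis_field_in_V: "basis_field i \<in> V"
proof -
  have "(\<lambda>x. basis_field i x j) \<in> borel_measurable \<mu>" for j
  proof -
    have "{x \<in> space \<mu>. enat i < \<nu> x} \<in> sets \<mu>"
      using measurable_sets[OF nu_measurable, of "{n. enat i < n}"] by (simp add: vimage_def)
    then have "(\<lambda>x. if enat i < \<nu> x then complex_of_real (weight x) else 0) \<in> borel_measurable \<mu>"
      by (intro measurable_If measurable_compose[OF weight(1) borel_measurable_of_real]) auto
    then show ?thesis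
      by (cases "j = i") (auto simp: basis_field_def hscale_def std_basis_def if_distrib cong: if_cong)
  qed
  then have m: "measurable_field \<mu> \<nu> (basis_field i)"
    by (simp add: measurable_field_def measurable_completion) (simp add: basis_field_def)
  have "sqnorm_integral \<mu> (basis_field i) \<le> (\<integral>\<^sup>+x. ennreal (weight x) \<partial>\<mu>)"
    unfolding sqnorm_integral_def
  proof (intro nn_integral_mono ennreal_leI)
    fix x
    \<comment> \<open>The bound of the weight by 1 makes its square integrable as well.\<close>
    have "(weight x)\<^sup>2 \<le> weight x"
      using weight(2,3)[of x] by (simp add: power2_eq_square mult_left_le)
    then show "(hnorm (basis_field i x))\<^sup>2 \<le> weight x"
      using weight(2)[of x] by (simp add: hnorm_basis_field)
  qed
  also have "\<dots> < \<infinity>"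
    using weight(4) weight(2) by (simp add: integrable_iff_bounded order_less_imp_le)
  finally show ?thesis
    using m by (simp add: direct_integral_iff)
qed

lemma V_hilb: "f \<in> V \<Longrightarrow> AE x in \<mu>. f x \<in> hilb (\<nu> x)"
  using measurable_fieldD(2) by (simp add: direct_integral_iff)

lemma check_involution:
  assumes "equivalent_measures \<mu> (check_measure \<mu>)"
  shows "nonsingular_involution \<mu> check"
proof
  show "check \<in> measurable \<mu> \<mu>"
    unfolding check_def[abs_def] by (rule measurable_mu_mu[OF borel_measurable_add_cantor])
  show "equivalent_measures (distr \<mu> \<mu> check) \<mu>"
    using equivalent_measures_sym[OF assms] by (simp add: check_measure_def)
qed simp

end

text \<open>Only what makes \<open>T\<close> a norm-preserving antilinear operator is assumed. The
  relations for \<open>q\<close> are left out, so that they can be either hypotheses or conclusions: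
  both directions of the equivalence use this locale.\<close>

locale antilinear_field = garding_wightman_triple +
  fixes q :: "cantor \<Rightarrow> vec \<Rightarrow> vec"
  assumes check_equivalent: "equivalent_measures \<mu> (check_measure \<mu>)"
    and nu_check: "AE x in \<mu>. \<nu> (check x) = \<nu> x"
    and q_measurable: "measurable_operator_field \<mu> \<nu> q"
    and q_isometry: "AE x in \<mu>. semilinear_isometry cnj (hilb (\<nu> x)) (hilb (\<nu> x)) (q x)"
begin

sublocale flip: nonsingular_involution \<mu> check
  by (rule check_involution[OF check_equivalent])

definition T :: "(cantor \<Rightarrow> vec) \<Rightarrow> cantor \<Rightarrow> vec"
  where "T f = (\<lambda>x. hscale (complex_of_real (flip.r x)) (q x (f (check x))))"

lemma V_hilb_check:
  assumes "f \<in> V"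
  shows "AE x in \<mu>. f (check x) \<in> hilb (\<nu> x)"
  using flip.AE_inv[OF V_hilb[OF assms]] nu_check by eventually_elim simp

lemma T_in_V: "f \<in> V \<Longrightarrow> T f \<in> V"
  and T_sqnorm: "f \<in> V \<Longrightarrow> sqnorm_integral \<mu> (T f) = sqnorm_integral \<mu> f"
  using weighted_composition[OF check_involution[OF check_equivalent] nu_check q_measurable q_isometry,
      of "\<lambda>_. 1" f]
  by (simp_all add: T_def)

lemma T_cong: "ae_eq \<mu> f g \<Longrightarrow> ae_eq \<mu> (T f) (T g)"
  unfolding ae_eq_def T_def using flip.AE_inv[of "\<lambda>x. f x = g x"] by (auto elim: eventually_mono)

lemma T_add:
  assumes "f \<in> V" "g \<in> V"
  shows "AE x in \<mu>. T (f + g) x = T f x + T g x"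
  using V_hilb_check[OF assms(1)] V_hilb_check[OF assms(2)] q_isometry
proof eventually_elim
  case (elim x)
  then show ?case
    using semilinear_isometryD(2)[OF elim(3,1,2)] by (simp only: T_def plus_fun_apply hscale_add)
qed

lemma T_scale:
  assumes "f \<in> V"
  shows "AE x in \<mu>. T (\<lambda>x. hscale a (f x)) x = hscale (cnj a) (T f x)"
  using V_hilb_check[OF assms] q_isometry
proof eventually_elim
  case (elim x)
  then show ?case
    using semilinear_isometryD(3)[OF elim(2,1), of a] by (simp add: T_def mult.commute)
qed

lemma T_T:
  assumes "f \<in> V"
  shows "AE x in \<mu>. T (T f) x = q x (q (check x) (f x))"
  using V_hilb[OF assms] q_isometry flip.AE_inv[OF q_isometry] nu_check flip.r_cancel
proof eventually_elim
  case (elim x)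
  have "q (check x) (f x) \<in> hilb (\<nu> x)"
    using semilinear_isometryD(1)[OF elim(3)] elim(1,4) by simp
  then have "T (T f) x = hscale (complex_of_real (flip.r x * flip.r (check x))) (q x (q (check x) (f x)))"
    using semilinear_isometryD(3)[OF elim(2), of _ "complex_of_real (flip.r (check x))"]
    by (simp add: T_def)
  then show ?case
    unfolding elim(5) by simp
qed

text \<open>The cocycle identity gives both orders of composition the same weight, and conjugating
  \<kappa> at the flipped point produces the sign. It is an equivalence at almost every point
  because it is used both to prove commutation and to extract the relation for \<open>q\<close>. The
  exponent is \<open>Suc k\<close> since positions count from 0.\<close>

lemma T_clifford_commute_iff:
  assumes f: "f \<in> V" and \<kappa>: "\<And>x. cmod (\<kappa> x) = 1"
    and conj: "\<And>x. cnj (\<kappa> (check x)) = (-1) ^ Suc k * \<kappa> x"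
  shows "AE x in \<mu>. T (clifford \<kappa> k f) x = clifford \<kappa> k (T f) x \<longleftrightarrow>
    q x (c k (check x) (f (check x + \<delta> k)))
      = hscale ((-1) ^ Suc k) (c k x (q (x + \<delta> k) (f (check x + \<delta> k))))"
  using q_isometry shift.AE_inv[OF q_isometry, of k] c_isometry[of k] flip.AE_inv[OF c_isometry[of k]]
    shift.AE_inv[OF V_hilb_check[OF f], of k] flip.AE_inv[OF nu_shift[of k]] nu_shift[of k] nu_check
    shift.r_pos[of k] shift.AE_inv[OF flip.r_pos, of k]
    r_cocycle[OF check_involution[OF check_equivalent] translation_involution[of k], OF check_add_delta]
proof eventually_elim
  case (elim x)
  let ?s = "(-1) ^ Suc k :: complex"
  let ?g = "f (check x + \<delta> k)"
  let ?A = "c k x (q (x + \<delta> k) ?g)" and ?B = "q x (c k (check x) ?g)"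
  \<comment> \<open>The common scalar factor of both sides; it can be cancelled because the weights
    are positive and \<kappa> has modulus 1.\<close>
  define m where "m = \<kappa> x * complex_of_real (shift.r k x * flip.r (x + \<delta> k))"
  have m0: "m \<noteq> 0"
    using elim(9,10) \<kappa>[of x] by (auto simp: m_def)
  have g: "?g \<in> hilb (\<nu> x)"
    using elim(5,7) by (simp add: check_add_delta)
  have "q (x + \<delta> k) ?g \<in> hilb (\<nu> x)"
    using semilinear_isometryD(1)[OF elim(2)] g elim(7) by simp
  then have A: "clifford \<kappa> k (T f) x = hscale m ?A"
    using semilinear_isometryD(3)[OF elim(3), of _ "complex_of_real (flip.r (x + \<delta> k))"]
    by (simp add: clifford_def T_def check_add_delta m_def mult_ac)
  have "c k (check x) ?g \<in> hilb (\<nu> x)"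
    using semilinear_isometryD(1)[OF elim(4)] g elim(8) by simp
  then have "T (clifford \<kappa> k f) x
      = hscale (cnj (\<kappa> (check x)) * complex_of_real (flip.r x * shift.r k (check x))) ?B"
    using semilinear_isometryD(3)[OF elim(1), of _ "\<kappa> (check x) * complex_of_real (shift.r k (check x))"]
    by (simp add: clifford_def T_def mult_ac)
  also have "\<dots> = hscale (?s * m) ?B"
    unfolding elim(11) conj m_def by (simp only: mult.assoc)
  finally have B: "T (clifford \<kappa> k f) x = hscale m (hscale ?s ?B)"
    by (simp add: mult_ac)
  have "hscale ?s ?B = ?A \<longleftrightarrow> ?B = hscale ?s ?A"
  proof
    assume "hscale ?s ?B = ?A"
    then have "hscale ?s ?A = hscale (?s * ?s) ?B"
      by (metis hscale_simps(4))
    then show "?B = hscale ?s ?A"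
      by (simp only: minus_one_power_square hscale_simps)
  next
    assume "?B = hscale ?s ?A"
    then have "hscale ?s ?B = hscale (?s * ?s) ?A"
      by (metis hscale_simps(4))
    then show "hscale ?s ?B = ?A"
      by (simp only: minus_one_power_square hscale_simps)
  qed
  then show ?case
    unfolding A B hscale_eq_iff[OF m0] .
qed

section \<open>Relations for \<open>T\<close> and relations for \<open>q\<close>\<close>

lemma T_quaternionic:
  assumes sq: "AE x in \<mu>. \<forall>v\<in>hilb (\<nu> x). q x (q (check x) v) = - v"
    and comm: "\<And>k. AE x in \<mu>. \<forall>v\<in>hilb (\<nu> x).
        q x (c k (check x) v) = hscale ((-1) ^ Suc k) (c k x (q (x + \<delta> k) v))"
  shows "invariant_quaternionic_structure \<mu> \<nu> c T"
proof -
  have clifford: "ae_eq \<mu> (T (clifford \<kappa> k f)) (clifford \<kappa> k (T f))"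
    if "f \<in> V" "\<And>x. cmod (\<kappa> x) = 1" "\<And>x. cnj (\<kappa> (check x)) = (-1) ^ Suc k * \<kappa> x" for f \<kappa> k
    unfolding ae_eq_def
    using T_clifford_commute_iff[of f \<kappa> k, OF that] comm[of k] shift.AE_inv[OF V_hilb_check[OF that(1)], of k] nu_shift[of k]
    by eventually_elim (simp add: check_add_delta)
  have "ae_eq \<mu> (T (T f)) (- f)" if "f \<in> V" for f
    unfolding ae_eq_def using T_T[OF that] sq V_hilb[OF that] by eventually_elim simp
  moreover have "ae_eq \<mu> (T (f + g)) (T f + T g)" if "f \<in> V" "g \<in> V" for f g
    unfolding ae_eq_def plus_fun_apply[of "T f"] by (rule T_add[OF that])
  moreover have "ae_eq \<mu> (T (\<lambda>x. hscale a (f x))) (\<lambda>x. hscale (cnj a) (T f x))" if "f \<in> V" for a f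
    unfolding ae_eq_def by (rule T_scale[OF that])
  moreover have "l2norm \<mu> (T f) = l2norm \<mu> f" if "f \<in> V" for f
    using T_sqnorm[OF that] l2norm_eq_iff[OF T_in_V[OF that] that] by simp
  moreover have "ae_eq \<mu> (T (J \<mu> c k f)) (J \<mu> c k (T f))" if "f \<in> V" for f k
    unfolding J_eq by (rule clifford[of f "J_phase k" k, OF that cmod_J_phase cnj_J_phase_check])
  moreover have "ae_eq \<mu> (T (J' \<mu> c k f)) (J' \<mu> c k (T f))" if "f \<in> V" for f k
    unfolding J'_eq by (rule clifford[of f "parity_sign (Suc k)" k, OF that cmod_parity_sign cnj_parity_sign_check])
  ultimately show ?thesis
    unfolding invariant_quaternionic_structure_def Let_def
    by (intro conjI ballI allI impI T_in_V T_cong)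
qed

text \<open>The relation for \<open>T\<close> at the countably many basis fields gives one null set
  off which the fibre identity holds on a basis. The composite of two antilinear isometries and -1
  are both linear isometries, so they then agree on the fibre.\<close>

lemma q_square:
  assumes "\<And>f. f \<in> V \<Longrightarrow> ae_eq \<mu> (T (T f)) (- f)"
  shows "AE x in \<mu>. \<forall>v\<in>hilb (\<nu> x). q x (q (check x) v) = - v"
proof -
  have "AE x in \<mu>. \<forall>i. q x (q (check x) (basis_field i x)) = - basis_field i x"
    unfolding AE_all_countable
  proof
    fix i
    show "AE x in \<mu>. q x (q (check x) (basis_field i x)) = - basis_field i x"
      using T_T[OF basis_field_in_V, of i] assms[OF basis_field_in_V, of i] unfolding ae_eq_def
      by eventually_elim simp
  qed
  then show ?thesis
    using q_isometry flip.AE_inv[OF q_isometry] nu_check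
  proof eventually_elim
    case (elim x)
    have A: "semilinear_isometry (\<lambda>a. a) (hilb (\<nu> x)) (hilb (\<nu> x)) (\<lambda>v. q x (q (check x) v))"
      using semilinear_isometry_comp[OF elim(3) elim(2)[folded elim(4)]] elim(4) by simp
    have B: "semilinear_isometry (\<lambda>a. a) (hilb (\<nu> x)) (hilb (\<nu> x)) (\<lambda>v. hscale (-1) v)"
      by (rule semilinear_isometry_hscale) (auto simp: semilinear_isometry_def)
    have "q x (q (check x) (std_basis (\<nu> x) i)) = hscale (-1) (std_basis (\<nu> x) i)" for i
    proof -
      have "hscale (weight x) (q x (q (check x) (std_basis (\<nu> x) i)))
          = q x (q (check x) (basis_field i x))"
        unfolding basis_field_def semilinear_isometryD(3)[OF A std_basis_hilb] ..
      also have "\<dots> = hscale (weight x) (hscale (-1) (std_basis (\<nu> x) i))"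
        using elim(1) unfolding basis_field_def uminus_eq_hscale by (simp only: hscale_simps mult.commute)
      finally show ?thesis
        using weight(2)[of x] hscale_eq_iff[of "complex_of_real (weight x)"]
        by (metis of_real_eq_0_iff order_less_irrefl)
    qed
    then show ?case
      using semilinear_isometry_eqI[OF A B] unfolding uminus_eq_hscale by blast
  qed
qed

text \<open>As for the square, a basis decides. The basis fields are evaluated at
  \<open>check x + \<delta> k\<close>, the point that both orders of composition look at.\<close>

lemma q_commute:
  assumes "\<And>f. f \<in> V \<Longrightarrow> ae_eq \<mu> (T (J \<mu> c k f)) (J \<mu> c k (T f))"
  shows "AE x in \<mu>. \<forall>v\<in>hilb (\<nu> x).
    q x (c k (check x) v) = hscale ((-1) ^ Suc k) (c k x (q (x + \<delta> k) v))"
proof -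
  have "AE x in \<mu>. \<forall>i. q x (c k (check x) (basis_field i (check x + \<delta> k)))
      = hscale ((-1) ^ Suc k) (c k x (q (x + \<delta> k) (basis_field i (check x + \<delta> k))))"
    unfolding AE_all_countable
  proof
    fix i
    show "AE x in \<mu>. q x (c k (check x) (basis_field i (check x + \<delta> k)))
      = hscale ((-1) ^ Suc k) (c k x (q (x + \<delta> k) (basis_field i (check x + \<delta> k))))"
      using T_clifford_commute_iff[of "basis_field i" "J_phase k" k, OF basis_field_in_V cmod_J_phase cnj_J_phase_check]
        assms[OF basis_field_in_V, of i] unfolding ae_eq_def J_eq
      by eventually_elim blast
  qed
  then show ?thesis
    using q_isometry shift.AE_inv[OF q_isometry, of k] c_isometry[of k] flip.AE_inv[OF c_isometry[of k]]
      flip.AE_inv[OF nu_shift[of k]] nu_shift[of k] nu_check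
  proof eventually_elim
    case (elim x)
    let ?H = "hilb (\<nu> x)" and ?w = "complex_of_real (weight (check x + \<delta> k))"
    have A: "semilinear_isometry cnj ?H ?H (\<lambda>v. q x (c k (check x) v))"
      using semilinear_isometry_comp[OF elim(5) elim(2)[folded elim(8)]] elim(8) by simp
    have "semilinear_isometry cnj ?H ?H (\<lambda>v. c k x (q (x + \<delta> k) v))"
      using semilinear_isometry_comp[OF elim(3) elim(4)[folded elim(7)]] elim(7) by simp
    then have B: "semilinear_isometry cnj ?H ?H (\<lambda>v. hscale ((-1) ^ Suc k) (c k x (q (x + \<delta> k) v)))"
      by (rule semilinear_isometry_hscale) (simp add: norm_power)
    have w: "?w \<noteq> 0"
      using weight(2)[of "check x + \<delta> k"] by simp
    have "q x (c k (check x) (std_basis (\<nu> x) i))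
        = hscale ((-1) ^ Suc k) (c k x (q (x + \<delta> k) (std_basis (\<nu> x) i)))" for i
    proof -
      \<comment> \<open>The multiplicity at the shifted and flipped point equals the one at
        \<open>x\<close>, so the basis of the right fibre appears.\<close>
      have bf: "basis_field i (check x + \<delta> k) = hscale ?w (std_basis (\<nu> x) i)"
        using elim(6,8) by (simp add: basis_field_def)
      have "hscale (cnj ?w) (q x (c k (check x) (std_basis (\<nu> x) i)))
          = q x (c k (check x) (basis_field i (check x + \<delta> k)))"
        unfolding bf by (rule semilinear_isometryD(3)[OF A std_basis_hilb, symmetric])
      also have "\<dots> = hscale ((-1) ^ Suc k) (c k x (q (x + \<delta> k) (basis_field i (check x + \<delta> k))))"
        using elim(1) by blast
      also have "\<dots> = hscale (cnj ?w) (hscale ((-1) ^ Suc k) (c k x (q (x + \<delta> k) (std_basis (\<nu> x) i))))"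
        unfolding bf by (rule semilinear_isometryD(3)[OF B std_basis_hilb])
      finally have "hscale (cnj ?w) (q x (c k (check x) (std_basis (\<nu> x) i)))
          = hscale (cnj ?w) (hscale ((-1) ^ Suc k) (c k x (q (x + \<delta> k) (std_basis (\<nu> x) i))))" .
      then show ?thesis
        using w hscale_eq_iff[of "cnj ?w"] by (metis complex_cnj_zero_iff)
    qed
    then show ?case
      using semilinear_isometry_eqI[OF A B] by blast
  qed
qed

end

section \<open>Disintegration of a quaternionic structure\<close>

lemma ae_eq_sym: "ae_eq \<mu> f g \<Longrightarrow> ae_eq \<mu> g f"
  by (simp add: ae_eq_def eq_commute)

lemma ae_eq_trans:
  assumes "ae_eq \<mu> f g" "ae_eq \<mu> g h"
  shows "ae_eq \<mu> f h"
  using assms unfolding ae_eq_def by eventually_elim simp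

text \<open>Pairs of rationals form a countable type, hence so do finite lists of such coefficients,
  and countably many almost-everywhere statements can be combined.\<close>

definition complex_rat :: "rat \<times> rat \<Rightarrow> complex"
  where "complex_rat p = Complex (of_rat (fst p)) (of_rat (snd p))"

lemma complex_rat_dense:
  assumes "0 < e"
  shows "\<exists>p. cmod (complex_rat p - z) < e"
proof -
  obtain a where a: "Re z < of_rat a" "of_rat a < Re z + e / 2"
    using of_rat_dense[of "Re z" "Re z + e / 2"] assms by auto
  obtain b where b: "Im z < of_rat b" "of_rat b < Im z + e / 2"
    using of_rat_dense[of "Im z" "Im z + e / 2"] assms by auto
  have "cmod (complex_rat (a, b) - z) \<le> \<bar>of_rat a - Re z\<bar> + \<bar>of_rat b - Im z\<bar>"
    using cmod_le[of "complex_rat (a, b) - z"] by (simp add: complex_rat_def)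
  also have "\<dots> < e"
    using a b by linarith
  finally show ?thesis
    by blast
qed

lemma combination_identity_extend:
  assumes G: "\<And>i. G i \<in> hilb n" and F: "\<And>i. F i \<in> hilb m"
    and u: "u \<in> hilb n" and v: "v \<in> hilb m"
    and rat: "\<And>l. hnorm (u - (\<Sum>i<length l. hscale (cnj (complex_rat (l ! i))) (G i)))
      = r * hnorm (v - (\<Sum>i<length l. hscale (complex_rat (l ! i)) (F i)))"
  shows "hnorm (u - (\<Sum>i<N. hscale (cnj (a i)) (G i))) = r * hnorm (v - (\<Sum>i<N. hscale (a i) (F i)))"
proof -
  have "\<forall>k i. \<exists>p. cmod (complex_rat p - a i) < 1 / real (Suc k)"
    by (intro allI complex_rat_dense) simp
  then obtain p where p: "\<And>k i. cmod (complex_rat (p k i) - a i) < 1 / real (Suc k)"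
    by metis
  have lim: "(\<lambda>k. complex_rat (p k i)) \<longlonglongrightarrow> a i" for i
  proof (rule LIM_zero_cancel, rule Lim_null_comparison)
    show "\<forall>\<^sub>F k in sequentially. norm (complex_rat (p k i) - a i) \<le> 1 / real (Suc k)"
      by (intro always_eventually allI less_imp_le p)
    show "(\<lambda>k. 1 / real (Suc k)) \<longlonglongrightarrow> 0"
      by (rule LIMSEQ_Suc[OF lim_1_over_n])
  qed
  have eq: "hnorm (u - (\<Sum>i<N. hscale (cnj (complex_rat (p k i))) (G i)))
      = r * hnorm (v - (\<Sum>i<N. hscale (complex_rat (p k i)) (F i)))" for k
  proof -
    \<comment> \<open>The first \<open>N\<close> rational approximations are packed into a list, the
      form in which the hypothesis is indexed.\<close>
    let ?l = "map (p k) [0..<N]"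
    have "(\<Sum>i<length ?l. hscale (cnj (complex_rat (?l ! i))) (G i)) = (\<Sum>i<N. hscale (cnj (complex_rat (p k i))) (G i))"
      "(\<Sum>i<length ?l. hscale (complex_rat (?l ! i)) (F i)) = (\<Sum>i<N. hscale (complex_rat (p k i)) (F i))"
      by (rule sum.cong; simp)+
    then show ?thesis
      using rat[of ?l] by (simp only:)
  qed
  have "(\<lambda>k. hnorm (u - (\<Sum>i<N. hscale (cnj (complex_rat (p k i))) (G i))))
      \<longlonglongrightarrow> hnorm (u - (\<Sum>i<N. hscale (cnj (a i)) (G i)))"
    by (rule tendsto_combination[OF G u]) (intro tendsto_cnj lim)
  moreover have "(\<lambda>k. hnorm (u - (\<Sum>i<N. hscale (cnj (complex_rat (p k i))) (G i))))
      \<longlonglongrightarrow> r * hnorm (v - (\<Sum>i<N. hscale (a i) (F i)))"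
    unfolding eq by (intro tendsto_mult tendsto_const tendsto_combination[OF F v] lim)
  ultimately show ?thesis
    by (rule LIMSEQ_unique)
qed

locale quaternionic_triple = garding_wightman_triple +
  fixes Q :: "(cantor \<Rightarrow> vec) \<Rightarrow> cantor \<Rightarrow> vec"
  assumes quaternionic: "invariant_quaternionic_structure \<mu> \<nu> c Q"
begin

lemma Q_in_V: "f \<in> V \<Longrightarrow> Q f \<in> V"
  and Q_cong: "f \<in> V \<Longrightarrow> g \<in> V \<Longrightarrow> ae_eq \<mu> f g \<Longrightarrow> ae_eq \<mu> (Q f) (Q g)"
  and Q_add: "f \<in> V \<Longrightarrow> g \<in> V \<Longrightarrow> ae_eq \<mu> (Q (f + g)) (Q f + Q g)"
  and Q_scale: "f \<in> V \<Longrightarrow> ae_eq \<mu> (Q (\<lambda>x. hscale a (f x))) (\<lambda>x. hscale (cnj a) (Q f x))"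
  and Q_l2norm: "f \<in> V \<Longrightarrow> l2norm \<mu> (Q f) = l2norm \<mu> f"
  and Q_Q: "f \<in> V \<Longrightarrow> ae_eq \<mu> (Q (Q f)) (- f)"
  and Q_J: "f \<in> V \<Longrightarrow> ae_eq \<mu> (Q (J \<mu> c k f)) (J \<mu> c k (Q f))"
  and Q_J': "f \<in> V \<Longrightarrow> ae_eq \<mu> (Q (J' \<mu> c k f)) (J' \<mu> c k (Q f))"
  using quaternionic by (simp_all add: invariant_quaternionic_structure_def Let_def)

lemma Q_sqnorm: "f \<in> V \<Longrightarrow> sqnorm_integral \<mu> (Q f) = sqnorm_integral \<mu> f"
  using Q_l2norm l2norm_eq_iff Q_in_V by blast

lemma J_in_V: "f \<in> V \<Longrightarrow> J \<mu> c k f \<in> V"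
  unfolding J_eq by (rule clifford_in_V[OF J_phase_measurable cmod_J_phase])

lemma J'_in_V: "f \<in> V \<Longrightarrow> J' \<mu> c k f \<in> V"
  unfolding J'_eq by (rule clifford_in_V[OF parity_sign_measurable cmod_parity_sign])

lemma coord_sign_in_V: "f \<in> V \<Longrightarrow> (\<lambda>x. hscale (coord_sign k x) (f x)) \<in> V"
  by (rule direct_integral_scale[of _ 1]) (auto intro: measurable_completion)

text \<open>\<open>Q\<close> commutes with the product of \<open>J\<close> and \<open>J'\<close>,
  which is \<i> times the coordinate sign. Moving \<open>Q\<close> past \<i> conjugates it, so
  \<open>Q\<close> must anticommute with the sign.\<close>

lemma Q_coord_sign:
  assumes f: "f \<in> V"
  shows "AE x in \<mu>. Q (\<lambda>x. hscale (coord_sign k x) (f x)) x = hscale (- coord_sign k x) (Q f x)"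
proof -
  define g where "g = (\<lambda>x. hscale (coord_sign k x) (f x))"
  have g: "g \<in> V"
    unfolding g_def by (rule coord_sign_in_V[OF f])
  have "ae_eq \<mu> (J \<mu> c k (J' \<mu> c k f)) (\<lambda>x. hscale \<i> (g x))"
    using J_J'[OF f, of k] by (simp add: ae_eq_def g_def)
  then have "ae_eq \<mu> (Q (J \<mu> c k (J' \<mu> c k f))) (Q (\<lambda>x. hscale \<i> (g x)))"
    by (intro Q_cong J_in_V J'_in_V f direct_integral_const_scale g)
  then have 1: "ae_eq \<mu> (Q (J \<mu> c k (J' \<mu> c k f))) (\<lambda>x. hscale (cnj \<i>) (Q g x))"
    by (rule ae_eq_trans[OF _ Q_scale[OF g]])
  have "ae_eq \<mu> (J \<mu> c k (Q (J' \<mu> c k f))) (J \<mu> c k (J' \<mu> c k (Q f)))"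
    unfolding J_eq by (intro clifford_cong Q_J' f)
  then have "ae_eq \<mu> (Q (J \<mu> c k (J' \<mu> c k f))) (J \<mu> c k (J' \<mu> c k (Q f)))"
    by (rule ae_eq_trans[OF Q_J[OF J'_in_V[OF f]]])
  then have "AE x in \<mu>. hscale (cnj \<i>) (Q g x) = J \<mu> c k (J' \<mu> c k (Q f)) x"
    using ae_eq_trans[OF ae_eq_sym[OF 1]] unfolding ae_eq_def by blast
  then show ?thesis
    unfolding g_def[symmetric] using J_J'[OF Q_in_V[OF f], of k]
  proof eventually_elim
    case (elim x)
    have "Q g x = hscale \<i> (hscale (cnj \<i>) (Q g x))"
      by simp
    also have "\<dots> = hscale (- coord_sign k x) (Q f x)"
      unfolding elim by (simp add: mult.assoc[symmetric])
    finally show ?case .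
  qed
qed

section \<open>Restriction to cylinder sets\<close>

definition cut :: "cantor set \<Rightarrow> (cantor \<Rightarrow> vec) \<Rightarrow> cantor \<Rightarrow> vec"
  where "cut A f = (\<lambda>x. hscale (of_bool (x \<in> A)) (f x))"

lemma cut_in_V: "A \<in> sets \<mu> \<Longrightarrow> f \<in> V \<Longrightarrow> cut A f \<in> V"
  unfolding cut_def
proof (rule direct_integral_scale[of _ 1])
  assume "A \<in> sets \<mu>"
  then have "(\<lambda>x. if x \<in> A then 1 else 0 :: complex) \<in> borel_measurable \<mu>"
    by (intro measurable_If) auto
  then show "(\<lambda>x. of_bool (x \<in> A) :: complex) \<in> borel_measurable (completion \<mu>)"
    unfolding of_bool_def by (rule measurable_completion)
qed auto

lemma sqnorm_cut:
  "sqnorm_integral \<mu> (cut A f) = (\<integral>\<^sup>+x. ennreal ((hnorm (f x))\<^sup>2) * indicator A x \<partial>\<mu>)"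
  unfolding sqnorm_integral_def by (intro nn_integral_cong) (auto simp: cut_def indicator_def)

lemma check_measurable: "check \<in> measurable \<mu> \<mu>"
  unfolding check_def[abs_def] by (rule measurable_mu_mu[OF borel_measurable_add_cantor])

lemma check_vimage_sets: "A \<in> sets \<mu> \<Longrightarrow> check -` A \<in> sets \<mu>"
  using measurable_sets[OF check_measurable, of A] by simp

text \<open>The preimage under \<open>check\<close> is also the image. Closure under complements and
  intersections reduces all cylinder sets to one coordinate.\<close>

definition swaps :: "cantor set \<Rightarrow> bool"
  where "swaps A \<longleftrightarrow> A \<in> sets \<mu> \<and> (\<forall>f\<in>V. ae_eq \<mu> (Q (cut A f)) (cut (check -` A) (Q f)))"

lemma swapsD: "swaps A \<Longrightarrow> f \<in> V \<Longrightarrow> AE x in \<mu>. Q (cut A f) x = cut (check -` A) (Q f) x"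
  by (simp add: swaps_def ae_eq_def)

lemma swaps_coord: "swaps {x. x k = 1}"
  unfolding swaps_def
proof (intro conjI ballI)
  show "{x. x k = 1} \<in> sets \<mu>"
    using sets_coordinate[of k "{1}"] by (simp add: sets_mu)
  fix f assume f: "f \<in> V"
  define g where "g = (\<lambda>x. hscale (coord_sign k x) (f x))"
  \<comment> \<open>The indicator of \<open>x k = 1\<close> is half of 1 minus the coordinate sign;
    \<open>h\<close> carries the minus sign because only sums and scalar multiples pass through
    \<open>Q\<close>.\<close>
  define h where "h = (\<lambda>x. hscale (-1) (g x))"
  have g: "g \<in> V"
    unfolding g_def by (rule coord_sign_in_V[OF f])
  have h: "h \<in> V"
    unfolding h_def by (rule direct_integral_const_scale[OF g])
  have cut: "cut {x. x k = 1} f = (\<lambda>x. hscale (1/2) ((f + h) x))"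
    by (auto simp: cut_def h_def g_def coord_sign_def hscale_def fun_eq_iff)
  show "ae_eq \<mu> (Q (cut {x. x k = 1} f)) (cut (check -` {x. x k = 1}) (Q f))"
    unfolding ae_eq_def cut
    using Q_scale[OF direct_integral_add[OF f h], of "1/2"] Q_add[OF f h] Q_scale[OF g, of "-1", folded h_def]
      Q_coord_sign[OF f, of k, folded g_def]
    unfolding ae_eq_def
  proof eventually_elim
    case (elim x)
    show ?case
      unfolding elim(1) unfolding trans[OF elim(2) plus_fun_apply] elim(3,4)
      by (auto simp: cut_def coord_sign_def hscale_def fun_eq_iff check_eq_1_iff)
  qed
qed

lemma swaps_UNIV: "swaps UNIV"
proof -
  have "cut UNIV f = f" for f
    by (simp add: cut_def)
  then show ?thesis
    using sets.top[of \<mu>] by (simp add: swaps_def ae_eq_def)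
qed

lemma swaps_Compl:
  assumes A: "swaps A"
  shows "swaps (- A)"
  unfolding swaps_def
proof (intro conjI ballI)
  have sA: "A \<in> sets \<mu>"
    using A by (simp add: swaps_def)
  then show "- A \<in> sets \<mu>"
    using sets.compl_sets[OF sA] by (simp add: Compl_eq_Diff_UNIV)
  fix f assume f: "f \<in> V"
  define h where "h = (\<lambda>x. hscale (-1) (cut A f x))"
  have h: "h \<in> V"
    unfolding h_def by (intro direct_integral_const_scale cut_in_V sA f)
  have cut: "cut (- A) f = f + h"
    by (auto simp: cut_def h_def hscale_def fun_eq_iff)
  show "ae_eq \<mu> (Q (cut (- A) f)) (cut (check -` (- A)) (Q f))"
    unfolding cut
    using Q_add[OF f h] Q_scale[OF cut_in_V[OF sA f], of "-1", folded h_def] swapsD[OF A f]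
    unfolding ae_eq_def
  proof eventually_elim
    case (elim x)
    show ?case
      unfolding trans[OF elim(1) plus_fun_apply] elim(2,3) by (auto simp: cut_def hscale_def fun_eq_iff)
  qed
qed

lemma swaps_Int:
  assumes A: "swaps A" and B: "swaps B"
  shows "swaps (A \<inter> B)"
  unfolding swaps_def
proof (intro conjI ballI)
  have s: "A \<in> sets \<mu>" "B \<in> sets \<mu>"
    using A B by (simp_all add: swaps_def)
  then show "A \<inter> B \<in> sets \<mu>"
    by blast
  fix f assume f: "f \<in> V"
  have cut: "cut (A \<inter> B) f = cut A (cut B f)"
    by (auto simp: cut_def fun_eq_iff)
  show "ae_eq \<mu> (Q (cut (A \<inter> B) f)) (cut (check -` (A \<inter> B)) (Q f))"
    unfolding cut ae_eq_def using swapsD[OF A cut_in_V[OF s(2) f]] swapsD[OF B f]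
  proof eventually_elim
    case (elim x)
    show ?case
      unfolding elim(1) unfolding cut_def[of "check -` A"] elim(2) by (auto simp: cut_def)
  qed
qed

lemma swaps_coord_in: "swaps {x. x k \<in> B}"
proof -
  have empty: "swaps {}"
    using swaps_Compl[OF swaps_UNIV] by simp
  have zero: "swaps {x. x k = 0}"
  proof -
    have "{x :: cantor. x k = 0} = - {x. x k = 1}"
      by (auto simp: bit_not_one_iff)
    then show ?thesis
      using swaps_Compl[OF swaps_coord[of k]] by simp
  qed
  have "{x :: cantor. x k \<in> B} \<in> {UNIV, {}, {x. x k = 0}, {x. x k = 1}}"
  proof (cases "0 \<in> B"; cases "1 \<in> B")
    assume "0 \<in> B" "1 \<in> B"
    then have "b \<in> B" for b
      by (cases b) auto
    then show ?thesis
      by simp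
  next
    assume "0 \<in> B" "1 \<notin> B"
    then have "b \<in> B \<longleftrightarrow> b = 0" for b
      by (cases b) auto
    then show ?thesis
      by simp
  next
    assume "0 \<notin> B" "1 \<in> B"
    then have "b \<in> B \<longleftrightarrow> b = 1" for b
      by (cases b) auto
    then show ?thesis
      by simp
  next
    assume "0 \<notin> B" "1 \<notin> B"
    then have "b \<notin> B" for b
      by (cases b) auto
    then show ?thesis
      by simp
  qed
  then show ?thesis
    using empty zero swaps_UNIV swaps_coord[of k] by auto
qed

lemma swaps_cylinder: "finite S \<Longrightarrow> swaps {x. \<forall>j\<in>S. x j \<in> B j}"
proof (induction S rule: finite_induct)
  case empty
  then show ?case
    using swaps_UNIV by simp
next
  case (insert k S)
  have "{x. \<forall>j\<in>insert k S. x j \<in> B j} = {x. x k \<in> B k} \<inter> {x. \<forall>j\<in>S. x j \<in> B j}"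
    by auto
  then show ?case
    using swaps_Int[OF swaps_coord_in[of k "B k"] insert.IH] by simp
qed

text \<open>\<open>Q\<close> preserves norms and moves restriction from a cylinder set to its flip,
  so both measures agree on cylinder sets, and these determine a finite measure. \<open>F\<close>
  and \<open>G\<close> are Borel versions of the squared norms, which are measurable only for the
  completion.\<close>

lemma sqnorm_transport:
  assumes f: "f \<in> V" and [measurable]: "F \<in> borel_measurable \<mu>" "G \<in> borel_measurable \<mu>"
    and F: "AE x in \<mu>. ennreal ((hnorm (Q f x))\<^sup>2) = F x"
    and G: "AE x in \<mu>. ennreal ((hnorm (f x))\<^sup>2) = G x"
  shows "density \<mu> F = distr (density \<mu> G) \<mu> check"
proof (rule measure_eqI_PiM_infinite[where I = UNIV and M = "\<lambda>_. borel"])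
  note check_measurable[measurable]
  show "sets (density \<mu> F) = sets (Pi\<^sub>M UNIV (\<lambda>_. borel))"
    "sets (distr (density \<mu> G) \<mu> check) = sets (Pi\<^sub>M UNIV (\<lambda>_. borel))"
    by (simp_all add: sets_mu sets_PiM_equal_borel)
  show "finite_measure (density \<mu> F)"
  proof (rule finite_measureI)
    have "emeasure (density \<mu> F) UNIV = (\<integral>\<^sup>+x. F x \<partial>\<mu>)"
      by (subst emeasure_density) (use sets.top[of \<mu>] in auto)
    also have "\<dots> = sqnorm_integral \<mu> (Q f)"
      unfolding sqnorm_integral_def using F by (intro nn_integral_cong_AE) auto
    also have "\<dots> < \<infinity>"
      using Q_in_V[OF f] by (simp add: direct_integral_iff)
    finally show "emeasure (density \<mu> F) (space (density \<mu> F)) \<noteq> \<infinity>"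
      by simp
  qed
  fix B :: "nat \<Rightarrow> bit set" and S :: "nat set"
  assume "finite S"
  define A where "A = {x. \<forall>j\<in>S. x j \<in> B j}"
  have emb: "prod_emb UNIV (\<lambda>_. borel) S (Pi\<^sub>E S B) = A"
    by (auto simp: prod_emb_def A_def PiE_def Pi_iff)
  have swaps: "swaps A"
    unfolding A_def by (rule swaps_cylinder[OF \<open>finite S\<close>])
  then have [measurable]: "A \<in> sets \<mu>"
    by (simp add: swaps_def)
  have A': "check -` A \<in> sets \<mu>"
    by (rule check_vimage_sets) measurable
  \<comment> \<open>The flip of a cylinder set is again one, and flipping it once more returns
    \<open>A\<close>.\<close>
  have "swaps (check -` A)"
  proof -
    have "{x. \<forall>j\<in>S. check x j \<in> B j} = {x. \<forall>j\<in>S. x j \<in> {b. b + 1 \<in> B j}}"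
      by (simp add: check_def)
    then show ?thesis
      using swaps_cylinder[OF \<open>finite S\<close>, of "\<lambda>j. {b. b + 1 \<in> B j}"] by (simp add: A_def)
  qed
  then have "AE x in \<mu>. Q (cut (check -` A) f) x = cut A (Q f) x"
    using swapsD[of "check -` A", OF _ f] by (simp add: vimage_def)
  then have "sqnorm_integral \<mu> (cut A (Q f)) = sqnorm_integral \<mu> (Q (cut (check -` A) f))"
    by (intro sqnorm_integral_cong_AE) auto
  also have "\<dots> = sqnorm_integral \<mu> (cut (check -` A) f)"
    by (intro Q_sqnorm cut_in_V A' f)
  finally have eq: "(\<integral>\<^sup>+x. ennreal ((hnorm (Q f x))\<^sup>2) * indicator A x \<partial>\<mu>)
      = (\<integral>\<^sup>+x. ennreal ((hnorm (f x))\<^sup>2) * indicator (check -` A) x \<partial>\<mu>)"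
    by (simp add: sqnorm_cut)
  have "emeasure (density \<mu> F) A = (\<integral>\<^sup>+x. F x * indicator A x \<partial>\<mu>)"
    by (rule emeasure_density) measurable
  also have "\<dots> = (\<integral>\<^sup>+x. ennreal ((hnorm (Q f x))\<^sup>2) * indicator A x \<partial>\<mu>)"
    using F by (intro nn_integral_cong_AE) auto
  also have "\<dots> = (\<integral>\<^sup>+x. G x * indicator (check -` A) x \<partial>\<mu>)"
    unfolding eq using G by (intro nn_integral_cong_AE) auto
  also have "\<dots> = emeasure (density \<mu> G) (check -` A)"
    using A' by (intro emeasure_density[symmetric]) auto
  also have "\<dots> = emeasure (distr (density \<mu> G) \<mu> check) A"
    by (subst emeasure_distr) auto
  finally show "emeasure (density \<mu> F) (prod_emb UNIV (\<lambda>_. borel) S (Pi\<^sub>E S B))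
      = emeasure (distr (density \<mu> G) \<mu> check) (prod_emb UNIV (\<lambda>_. borel) S (Pi\<^sub>E S B))"
    unfolding emb .
qed

section \<open>Equivalence of the measures and the pointwise norm identity\<close>

lemma ex_borel_sqnorm:
  assumes "f \<in> V"
  obtains F where "F \<in> borel_measurable \<mu>" "AE x in \<mu>. ennreal ((hnorm (f x))\<^sup>2) = F x"
proof -
  have "(\<lambda>x. ennreal ((hnorm (f x))\<^sup>2)) \<in> borel_measurable (completion \<mu>)"
    using hnorm_measurable[of f] assms by (simp add: direct_integral_iff)
  from completion_ex_borel_measurable[OF this] show ?thesis
    using that by blast
qed

text \<open>All fibres are nonzero, so the basis field of index 0 vanishes nowhere. Its image under
  \<open>Q\<close> has no mass on \<open>A\<close>, hence by transport the field itself has none on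
  the flip of \<open>A\<close>, which is possible only if the flip is null.\<close>

lemma check_vimage_null:
  assumes "A \<in> null_sets \<mu>"
  shows "check -` A \<in> null_sets \<mu>"
proof -
  let ?f = "basis_field 0"
  obtain F where F: "F \<in> borel_measurable \<mu>" "AE x in \<mu>. ennreal ((hnorm (Q ?f x))\<^sup>2) = F x"
    using ex_borel_sqnorm[OF Q_in_V[OF basis_field_in_V[of 0]]] .
  obtain G where G: "G \<in> borel_measurable \<mu>" "AE x in \<mu>. ennreal ((hnorm (?f x))\<^sup>2) = G x"
    using ex_borel_sqnorm[OF basis_field_in_V[of 0]] .
  have s: "check -` A \<in> sets \<mu>"
    using assms by (intro check_vimage_sets) auto
  have "emeasure (density \<mu> F) A = 0"
    using assms absolutely_continuousI_density[OF F(1)]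
    by (auto simp: absolutely_continuous_def null_sets_def)
  then have "emeasure (density \<mu> G) (check -` A) = 0"
    unfolding sqnorm_transport[OF basis_field_in_V F(1) G(1) F(2) G(2)]
    using assms check_measurable by (subst (asm) emeasure_distr) (auto simp: measurable_def)
  then have "check -` A \<in> null_sets (density \<mu> G)"
    using s by (simp add: null_sets_def)
  then have "AE x in \<mu>. x \<in> check -` A \<longrightarrow> G x = 0"
    using null_sets_density_iff[OF G(1), of "check -` A"] by simp
  then have "AE x in \<mu>. x \<notin> check -` A"
    using G(2)
  proof eventually_elim
    case (elim x)
    have "0 < \<nu> x"
      using nu_nonzero[of x] by (simp add: zero_less_iff_neq_zero)
    then have "hnorm (basis_field 0 x) = weight x"
      by (simp add: hnorm_basis_field zero_enat_def[symmetric])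
    then have "G x = ennreal ((weight x)\<^sup>2)"
      using elim(2) by simp
    then have "G x \<noteq> 0"
      using weight(2)[of x] by (simp add: ennreal_eq_0_iff not_le)
    then show ?case
      using elim(1) by blast
  qed
  then show ?thesis
    using AE_iff_null_sets[OF s] by simp
qed

lemma null_sets_check_measure: "A \<in> null_sets (check_measure \<mu>) \<longleftrightarrow> A \<in> sets \<mu> \<and> check -` A \<in> null_sets \<mu>"
proof (cases "A \<in> sets \<mu>")
  case True
  then have "emeasure (check_measure \<mu>) A = emeasure \<mu> (check -` A)"
    unfolding check_measure_def by (subst emeasure_distr[OF check_measurable]) simp_all
  then show ?thesis
    using True check_vimage_sets[OF True] by (simp add: null_sets_def check_measure_def)
next
  case False
  then show ?thesis
    by (simp add: null_sets_def check_measure_def)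
qed

lemma check_equivalent: "equivalent_measures \<mu> (check_measure \<mu>)"
proof -
  have "A \<in> null_sets \<mu>" if "check -` A \<in> null_sets \<mu>" for A
    using check_vimage_null[OF that] by (simp add: vimage_def)
  then have "null_sets (check_measure \<mu>) \<subseteq> null_sets \<mu>"
    unfolding subset_iff null_sets_check_measure by blast
  moreover have "null_sets \<mu> \<subseteq> null_sets (check_measure \<mu>)"
    unfolding subset_iff null_sets_check_measure using check_vimage_null null_setsD2 by blast
  moreover have "sets \<mu> = sets (check_measure \<mu>)"
    by (simp add: check_measure_def)
  ultimately show ?thesis
    by (simp only: equivalent_measures_def absolutely_continuous_def simp_thms)
qed

sublocale flip: nonsingular_involution \<mu> check
  by (rule check_involution[OF check_equivalent])

text \<open>The flip of the measure with density \<open>G\<close> has density \<rho> times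
  \<open>G\<close> at the flipped point. Uniqueness of densities turns the equality of measures into
  an equality at almost every point.\<close>

lemma hnorm_Q:
  assumes f: "f \<in> V"
  shows "AE x in \<mu>. hnorm (Q f x) = flip.r x * hnorm (f (check x))"
proof -
  obtain F where F[measurable]: "F \<in> borel_measurable \<mu>" and F': "AE x in \<mu>. ennreal ((hnorm (Q f x))\<^sup>2) = F x"
    using ex_borel_sqnorm[OF Q_in_V[OF f]] .
  obtain G where G[measurable]: "G \<in> borel_measurable \<mu>" and G': "AE x in \<mu>. ennreal ((hnorm (f x))\<^sup>2) = G x"
    using ex_borel_sqnorm[OF f] .
  have "density \<mu> F = density \<mu> (\<lambda>x. flip.\<rho> x * G (check x))"
    unfolding sqnorm_transport[OF f F G F' G']
  proof (rule measure_eqI)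
    fix A assume "A \<in> sets (distr (density \<mu> G) \<mu> check)"
    then have [measurable]: "A \<in> sets \<mu>"
      by simp
    have A': "check -` A \<in> sets \<mu>"
      by (rule check_vimage_sets) measurable
    have "emeasure (distr (density \<mu> G) \<mu> check) A = emeasure (density \<mu> G) (check -` A)"
      by (subst emeasure_distr) auto
    also have "\<dots> = (\<integral>\<^sup>+x. G x * indicator A (check x) \<partial>\<mu>)"
      using A' by (subst emeasure_density) (auto simp: indicator_def)
    also have "\<dots> = (\<integral>\<^sup>+x. flip.\<rho> x * (\<lambda>y. G y * indicator A (check y)) (check x) \<partial>\<mu>)"
      by (rule flip.nn_integral_inv_borel[symmetric]) measurable
    also have "\<dots> = emeasure (density \<mu> (\<lambda>x. flip.\<rho> x * G (check x))) A"
      by (subst emeasure_density) (auto simp: mult.assoc)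
    finally show "emeasure (distr (density \<mu> G) \<mu> check) A
      = emeasure (density \<mu> (\<lambda>x. flip.\<rho> x * G (check x))) A" .
  qed simp
  then have "AE x in \<mu>. F x = flip.\<rho> x * G (check x)"
    by (intro density_unique) measurable
  then show ?thesis
    using F' flip.AE_inv[OF G'] flip.r_facts V_hilb[OF Q_in_V[OF f]] flip.AE_inv[OF V_hilb[OF f]]
  proof eventually_elim
    case (elim x)
    have "ennreal ((hnorm (Q f x))\<^sup>2) = ennreal ((flip.r x)\<^sup>2) * ennreal ((hnorm (f (check x)))\<^sup>2)"
      using elim(1-4) by simp
    also have "\<dots> = ennreal ((flip.r x * hnorm (f (check x)))\<^sup>2)"
      by (simp add: ennreal_mult power_mult_distrib)
    finally have "(hnorm (Q f x))\<^sup>2 = (flip.r x * hnorm (f (check x)))\<^sup>2"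
      by (subst (asm) ennreal_inj) simp_all
    then show ?case
      using elim(4) hnorm_nonneg[OF elim(5)] hnorm_nonneg[OF elim(6)] by (simp add: power2_eq_iff_nonneg)
  qed
qed

section \<open>Images of the basis fields and equality of multiplicities\<close>

lemma zero_in_V: "(\<lambda>_. 0) \<in> V"
  by (simp add: direct_integral_iff measurable_field_def sqnorm_integral_def)

lemma Q_zero: "AE x in \<mu>. Q (\<lambda>_. 0) x = 0"
  using hnorm_Q[OF zero_in_V] V_hilb[OF Q_in_V[OF zero_in_V]]
proof eventually_elim
  case (elim x)
  show ?case
    by (rule hnorm_eq_0D[OF elim(2)]) (simp only: elim(1) hnorm_zero mult_zero_right)
qed

text \<open>Recursion on the length lets additivity of \<open>Q\<close>, which holds only almost
  everywhere, be applied one term at a time.\<close>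

primrec combination :: "(nat \<Rightarrow> complex) \<Rightarrow> nat \<Rightarrow> cantor \<Rightarrow> vec"
  where
    "combination b 0 = (\<lambda>_. 0)"
  | "combination b (Suc N) = combination b N + (\<lambda>x. hscale (b N) (basis_field N x))"

lemma combination_in_V: "combination b N \<in> V"
proof (induction N)
  case 0
  show ?case
    unfolding combination.simps by (rule zero_in_V)
next
  case (Suc N)
  then show ?case
    unfolding combination.simps
    by (intro direct_integral_add direct_integral_const_scale basis_field_in_V)
qed

lemma combination_apply: "combination b N x = (\<Sum>i<N. hscale (b i) (basis_field i x))"
proof (induction N)
  case (Suc N)
  show ?case
    unfolding combination.simps plus_fun_apply Suc.IH sum.lessThan_Suc ..
qed simp

lemma Q_combination: "AE x in \<mu>. Q (combination b N) x = (\<Sum>i<N. hscale (cnj (b i)) (Q (basis_field i) x))"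
proof (induction N)
  case 0
  show ?case
    unfolding combination.simps lessThan_0 sum.empty by (rule Q_zero)
next
  case (Suc N)
  show ?case
    unfolding combination.simps
    using Suc.IH Q_add[OF combination_in_V direct_integral_const_scale[OF basis_field_in_V], of b N "b N" N]
      Q_scale[OF basis_field_in_V, of "b N" N]
    unfolding ae_eq_def
  proof eventually_elim
    case (elim x)
    show ?case
      unfolding trans[OF elim(2) plus_fun_apply] elim(1,3) sum.lessThan_Suc ..
  qed
qed

text \<open>The norm identity for \<open>f\<close> minus a combination. With \<open>f = 0\<close> it
  yields orthonormality of the images; with general \<open>f\<close> it identifies
  \<open>Q f\<close>.\<close>

lemma hnorm_Q_combination:
  assumes f: "f \<in> V"
  shows "AE x in \<mu>. hnorm (Q f x - (\<Sum>i<N. hscale (cnj (b i)) (Q (basis_field i) x)))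
    = flip.r x * hnorm (f (check x) - (\<Sum>i<N. hscale (b i) (basis_field i (check x))))"
proof -
  define h where "h = (\<lambda>x. hscale (-1) (combination b N x))"
  have h: "h \<in> V"
    unfolding h_def by (rule direct_integral_const_scale[OF combination_in_V])
  show ?thesis
    using hnorm_Q[OF direct_integral_add[OF f h]] Q_add[OF f h] Q_combination[of b N]
      Q_scale[OF combination_in_V[of b N], of "-1", folded h_def]
    unfolding ae_eq_def
  proof eventually_elim
    case (elim x)
    have 1: "Q f x - (\<Sum>i<N. hscale (cnj (b i)) (Q (basis_field i) x)) = Q (f + h) x"
      unfolding trans[OF elim(2) plus_fun_apply] elim(4,3)
      by (simp add: fun_eq_iff hscale_def sum_vec_apply)
    have 2: "f (check x) - (\<Sum>i<N. hscale (b i) (basis_field i (check x))) = (f + h) (check x)"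
      by (simp add: fun_eq_iff h_def combination_apply hscale_def sum_vec_apply)
    show ?case
      unfolding 1 2 by (rule elim(1))
  qed
qed

lemma basis_field_hilb: "basis_field i x \<in> hilb (\<nu> x)"
  unfolding basis_field_def by (intro hilb_hscale std_basis_hilb)

lemma Q_basis_field_hilb: "AE x in \<mu>. \<forall>i. Q (basis_field i) x \<in> hilb (\<nu> x)"
  unfolding AE_all_countable using V_hilb[OF Q_in_V[OF basis_field_in_V]] by blast

text \<open>The exceptional null set may depend on the coefficients, so countably many rational
  coefficients come first and continuity gives the rest.\<close>

lemma hnorm_Q_combination_all:
  assumes f: "f \<in> V"
  shows "AE x in \<mu>. \<forall>N b. hnorm (Q f x - (\<Sum>i<N. hscale (cnj (b i)) (Q (basis_field i) x)))
    = flip.r x * hnorm (f (check x) - (\<Sum>i<N. hscale (b i) (basis_field i (check x))))"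
proof -
  have "AE x in \<mu>. \<forall>l. hnorm (Q f x - (\<Sum>i<length l. hscale (cnj (complex_rat (l ! i))) (Q (basis_field i) x)))
    = flip.r x * hnorm (f (check x) - (\<Sum>i<length l. hscale (complex_rat (l ! i)) (basis_field i (check x))))"
    unfolding AE_all_countable by (rule allI) (rule hnorm_Q_combination[OF f])
  then show ?thesis
    using Q_basis_field_hilb V_hilb[OF Q_in_V[OF f]] flip.AE_inv[OF V_hilb[OF f]]
  proof eventually_elim
    case (elim x)
    show ?case
    proof (intro allI, rule combination_identity_extend)
      show "Q (basis_field i) x \<in> hilb (\<nu> x)" for i
        using elim(2) by blast
      show "basis_field i (check x) \<in> hilb (\<nu> (check x))" for i
        by (rule basis_field_hilb)
    qed (use elim(1,3,4) in blast)+
  qed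
qed

text \<open>The scalar removes the factor \<open>flip.r x\<close> by which \<open>Q\<close> changes
  fibre norms and the weight of the basis field at the flipped point.\<close>

definition image_basis :: "cantor \<Rightarrow> nat \<Rightarrow> vec"
  where "image_basis x i = hscale (complex_of_real (1 / (flip.r x * weight (check x)))) (Q (basis_field i) x)"

lemma image_basis_orthonormal: "AE x in \<mu>. orthonormal_images (image_basis x) (\<nu> (check x)) (\<nu> x)"
  using hnorm_Q_combination_all[OF zero_in_V] Q_zero Q_basis_field_hilb flip.r_pos
proof eventually_elim
  case (elim x)
  define t where "t = flip.r x * weight (check x)"
  have t: "0 < t"
    using elim(4) weight(2)[of "check x"] by (simp add: t_def)
  show ?case
  proof
    show "image_basis x i \<in> hilb (\<nu> x)" for i
      using elim(3) unfolding image_basis_def by (intro hilb_hscale) blast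
    fix N and a :: "nat \<Rightarrow> complex"
    \<comment> \<open>Conjugated because \<open>Q\<close> is antilinear, and divided by
      \<open>t\<close> to match the normalisation of the images.\<close>
    define b where "b i = cnj (a i) / complex_of_real t" for i
    have "hnorm (0 - (\<Sum>i<N. hscale (cnj (b i)) (Q (basis_field i) x)))
        = flip.r x * hnorm (0 - (\<Sum>i<N. hscale (b i) (basis_field i (check x))))"
      using elim(1,2) by simp
    moreover have "(\<Sum>i<N. hscale (cnj (b i)) (Q (basis_field i) x)) = (\<Sum>i<N. hscale (a i) (image_basis x i))"
      by (simp add: image_basis_def b_def t_def[symmetric])
    moreover have "(\<Sum>i<N. hscale (b i) (basis_field i (check x)))
        = hscale (complex_of_real (1 / flip.r x)) (\<Sum>i<N. hscale (cnj (a i)) (std_basis (\<nu> (check x)) i))"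
      unfolding hscale_sum
    proof (rule sum.cong[OF refl])
      fix i
      have "b i * complex_of_real (weight (check x)) = complex_of_real (1 / flip.r x) * cnj (a i)"
        using elim(4) weight(2)[of "check x"] by (simp add: b_def t_def)
      then show "hscale (b i) (basis_field i (check x))
          = hscale (complex_of_real (1 / flip.r x)) (hscale (cnj (a i)) (std_basis (\<nu> (check x)) i))"
        by (simp only: basis_field_def hscale_simps)
    qed
    moreover have S: "(\<Sum>i<N. hscale (a i) (image_basis x i)) \<in> hilb (\<nu> x)"
      using elim(3) unfolding image_basis_def by (intro hilb_sum hilb_hscale) blast
    moreover have S': "(\<Sum>i<N. hscale (cnj (a i)) (std_basis (\<nu> (check x)) i)) \<in> hilb (\<nu> (check x))"
      by (intro hilb_sum hilb_hscale std_basis_hilb)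
    ultimately have "hnorm (\<Sum>i<N. hscale (a i) (image_basis x i))
        = flip.r x * hnorm (hscale (complex_of_real (1 / flip.r x)) (\<Sum>i<N. hscale (cnj (a i)) (std_basis (\<nu> (check x)) i)))"
      using hnorm_uminus[OF S] hnorm_uminus[OF hilb_hscale[OF S']] by (simp only: diff_0)
    also have "\<dots> = hnorm (\<Sum>i<N. hscale (cnj (a i)) (std_basis (\<nu> (check x)) i))"
      unfolding hnorm_hscale[OF S'] using elim(4) by (simp add: norm_divide)
    finally show "(hnorm (\<Sum>i<N. hscale (a i) (image_basis x i)))\<^sup>2
        = (\<Sum>i<N. if enat i < \<nu> (check x) then (cmod (a i))\<^sup>2 else 0)"
      by (simp only: hnorm_sq_std_combination complex_mod_cnj)
  qed
qed

text \<open>The orthonormal images bound the dimension at \<open>check x\<close> by the one at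
  \<open>x\<close>; the same bound at the flipped point is the reverse inequality.\<close>

lemma nu_check: "AE x in \<mu>. \<nu> (check x) = \<nu> x"
proof -
  have le: "AE x in \<mu>. \<nu> (check x) \<le> \<nu> x"
    using image_basis_orthonormal by eventually_elim (rule orthonormal_images.dimension_le)
  then show ?thesis
    using flip.AE_inv[OF le] by eventually_elim simp
qed

section \<open>The field \<open>q\<close> and the identification of \<open>Q\<close> with
  \<open>T\<close>\<close>

definition q :: "cantor \<Rightarrow> vec \<Rightarrow> vec"
  where "q x = antilinear_ext (image_basis x)"

lemma q_measurable: "measurable_operator_field \<mu> \<nu> q"
  unfolding measurable_operator_field_def
proof (intro allI impI)
  fix f j assume "measurable_field \<mu> \<nu> f"
  note [measurable] = measurable_fieldD(1)[OF this]
  have [measurable]: "(\<lambda>x. Q (basis_field i) x j) \<in> borel_measurable (completion \<mu>)" for i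
    using Q_in_V[OF basis_field_in_V[of i]] by (intro measurable_fieldD(1)) (simp add: direct_integral_iff)
  have [measurable]: "(\<lambda>x. weight (check x)) \<in> borel_measurable (completion \<mu>)"
    by (intro flip.measurable_compose_inv measurable_completion weight(1))
  have [measurable]: "flip.r \<in> borel_measurable (completion \<mu>)"
    by (intro measurable_completion flip.r_measurable)
  have [measurable]: "(\<lambda>x. cnj (f x i)) \<in> borel_measurable (completion \<mu>)" for i
    by (rule measurable_compose[OF measurable_fieldD(1)[OF \<open>measurable_field \<mu> \<nu> f\<close>]])
      (intro borel_measurable_continuous_onI continuous_intros)
  show "(\<lambda>x. q x (f x) j) \<in> borel_measurable (completion \<mu>)"
    unfolding q_def antilinear_ext_def image_basis_def hscale_def by measurable
qed

lemma q_isometry: "AE x in \<mu>. semilinear_isometry cnj (hilb (\<nu> x)) (hilb (\<nu> x)) (q x)"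
  using image_basis_orthonormal nu_check
proof eventually_elim
  case (elim x)
  show ?case
    using orthonormal_images.semilinear_isometry_ext[OF elim(1)] elim(2) by (simp add: q_def)
qed

sublocale antilinear_field \<mu> \<nu> c q
  by unfold_locales (rule check_equivalent nu_check q_measurable q_isometry)+

text \<open>Let the coefficients be those of the truncated basis expansion of
  \<open>f (check x)\<close>. The remainder tends to 0, so the images of the truncations converge to
  \<open>Q f x\<close>; by construction of \<open>q\<close> they also converge, in every coordinate,
  to \<open>T f x\<close>.\<close>

lemma Q_eq_T:
  assumes f: "f \<in> V"
  shows "ae_eq \<mu> (Q f) (T f)"
  unfolding ae_eq_def
  using hnorm_Q_combination_all[OF f] image_basis_orthonormal flip.AE_inv[OF V_hilb[OF f]]
    V_hilb[OF Q_in_V[OF f]] flip.r_pos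
proof eventually_elim
  case (elim x)
  interpret orthonormal_images "image_basis x" "\<nu> (check x)" "\<nu> x"
    by (rule elim(2))
  let ?v = "f (check x)"
  \<comment> \<open>Dividing the coefficients by \<open>w\<close> compensates the weight built into
    the basis fields.\<close>
  define w where "w = complex_of_real (weight (check x))"
  have w: "w \<noteq> 0"
    using weight(2)[of "check x"] by (simp add: w_def)
  have "(\<Sum>i<N. hscale (?v i / w) (basis_field i (check x))) = (\<Sum>i<N. hscale (?v i) (std_basis (\<nu> (check x)) i))" for N
    using w by (simp add: basis_field_def w_def[symmetric])
  moreover have "(\<Sum>i<N. hscale (cnj (?v i / w)) (Q (basis_field i) x)) = hscale (flip.r x) (partial ?v N)" for N
    unfolding partial_def hscale_sum
  proof (rule sum.cong[OF refl])
    fix i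
    have "cnj (?v i / w) = complex_of_real (flip.r x) * (cnj (?v i) * complex_of_real (1 / (flip.r x * weight (check x))))"
      using elim(5) weight(2)[of "check x"] by (simp add: w_def)
    then show "hscale (cnj (?v i / w)) (Q (basis_field i) x)
        = hscale (flip.r x) (hscale (cnj (?v i)) (image_basis x i))"
      by (simp only: image_basis_def hscale_simps)
  qed
  ultimately have "hnorm (Q f x - hscale (flip.r x) (partial ?v N))
      = flip.r x * hnorm (?v - (\<Sum>i<N. hscale (?v i) (std_basis (\<nu> (check x)) i)))" for N
    using elim(1)[rule_format, of "\<lambda>i. ?v i / w" N] by (simp only:)
  moreover have p: "hscale (flip.r x) (partial ?v N) \<in> hilb (\<nu> x)" for N
    by (intro hilb_hscale partial_hilb)
  ultimately have "hnorm (hscale (flip.r x) (partial ?v N) - Q f x)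
      = flip.r x * hnorm (?v - (\<Sum>i<N. hscale (?v i) (std_basis (\<nu> (check x)) i)))" for N
    using hnorm_diff_commute[OF elim(4) p, of N] by (simp only:)
  then have "(\<lambda>N. hnorm (hscale (flip.r x) (partial ?v N) - Q f x)) \<longlonglongrightarrow> 0"
    using tendsto_mult_right_zero[OF std_basis_expansion[OF elim(3)], of "flip.r x"] by simp
  note lim = tendsto_hnorm_coord[OF elim(4) p this]
  show "Q f x = T f x"
  proof
    fix j
    have "(\<lambda>N. complex_of_real (flip.r x) * partial ?v N j) \<longlonglongrightarrow> complex_of_real (flip.r x) * antilinear_ext (image_basis x) ?v j"
      by (intro tendsto_mult tendsto_const partial_tendsto_coord elim(3))
    then show "Q f x j = T f x j"
      using LIMSEQ_unique[OF lim[of j]] by (simp add: T_def q_def hscale_def)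
  qed
qed

text \<open>\<open>T (T f)\<close>, \<open>T (Q f)\<close> and \<open>Q (Q f)\<close> agree almost
  everywhere, the first two because \<open>T\<close> respects almost-everywhere equality.\<close>

lemma T_square: "f \<in> V \<Longrightarrow> ae_eq \<mu> (T (T f)) (- f)"
  by (rule ae_eq_trans[OF T_cong[OF ae_eq_sym[OF Q_eq_T]]
        ae_eq_trans[OF ae_eq_sym[OF Q_eq_T[OF Q_in_V]] Q_Q]])

lemma T_J: "f \<in> V \<Longrightarrow> ae_eq \<mu> (T (J \<mu> c k f)) (J \<mu> c k (T f))"
  by (rule ae_eq_trans[OF ae_eq_sym[OF Q_eq_T[OF J_in_V]]
        ae_eq_trans[OF Q_J clifford_cong[OF Q_eq_T, of _ "J_phase k" k, folded J_eq]]])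

end

theorem theorem3p10:
  fixes \<mu> :: "cantor measure"
    and \<nu> :: "cantor \<Rightarrow> enat"
    and c :: "nat \<Rightarrow> cantor \<Rightarrow> vec \<Rightarrow> vec"
  assumes "garding_wightman_triple \<mu> \<nu> c"
  shows "(\<exists>Q. invariant_quaternionic_structure \<mu> \<nu> c Q) \<longleftrightarrow>
    equivalent_measures \<mu> (check_measure \<mu>) \<and>
    (AE x in \<mu>. \<nu> (check x) = \<nu> x) \<and>
    (\<exists>q :: cantor \<Rightarrow> vec \<Rightarrow> vec.
      measurable_operator_field \<mu> \<nu> q \<and>
      (AE x in \<mu>. antilinear_isometry_between (hilb (\<nu> x)) (hilb (\<nu> (check x))) (q x)) \<and>
      (AE x in \<mu>. \<forall>v\<in>hilb (\<nu> x). q x (q (check x) v) = - v) \<and>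
      (\<forall>k. AE x in \<mu>. \<forall>v\<in>hilb (\<nu> x).
        q x (c k (check x) v) = hscale ((-1) ^ Suc k) (c k x (q (x + \<delta> k) v))))"
    (is "?lhs \<longleftrightarrow> ?equiv \<and> ?nu \<and> (\<exists>q. ?q q)")
proof
  assume ?lhs
  then obtain Q where Q: "invariant_quaternionic_structure \<mu> \<nu> c Q" ..
  interpret quaternionic_triple \<mu> \<nu> c Q
    using assms Q by (simp add: quaternionic_triple_def quaternionic_triple_axioms_def)
  have "AE x in \<mu>. antilinear_isometry_between (hilb (\<nu> x)) (hilb (\<nu> (check x))) (q x)"
    using q_isometry nu_check by eventually_elim (simp add: antilinear_isometry_iff)
  then have "?q q"
    using q_measurable q_square[OF T_square] q_commute[OF T_J] by blast
  then show "?equiv \<and> ?nu \<and> (\<exists>q. ?q q)"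
    using check_equivalent nu_check by blast
next
  assume rhs: "?equiv \<and> ?nu \<and> (\<exists>q. ?q q)"
  then obtain q where q: "?q q"
    by blast
  have "AE x in \<mu>. antilinear_isometry_between (hilb (\<nu> x)) (hilb (\<nu> (check x))) (q x)" "?nu"
    using rhs q by blast+
  \<comment> \<open>Equality of the multiplicities identifies the target fibre at
    \<open>check x\<close> with the fibre at \<open>x\<close>.\<close>
  then have "AE x in \<mu>. semilinear_isometry cnj (hilb (\<nu> x)) (hilb (\<nu> x)) (q x)"
    by eventually_elim (simp add: antilinear_isometry_iff)
  then interpret antilinear_field \<mu> \<nu> c q
    using assms rhs q by (simp add: antilinear_field_def antilinear_field_axioms_def)
  have "invariant_quaternionic_structure \<mu> \<nu> c T"
    using q by (intro T_quaternionic) blast+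
  then show ?lhs
    by blast
qed

end
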